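(* Let the network be a ring of $n$ rational agents (with a global orientation). Then the protocol "Knowledge Sharing in a Ring" (described in the context) is a distributed equilibrium for the Knowledge Sharing problem when no cheating agent pretends to be more than $n$ agents. That is, no agent can increase its expected utility by a unilateral deviation in which it pretends to be at most $n$ agents.
   Context: **Network and agents.** The network is a bidirectional, 2-vertex-connected graph $G=(V,E)$ with $n$ nodes ($n$ always denotes the actual number of nodes). Each node is an agent with unlimited computational power. Agents communicate over edges in synchronous rounds and all start at round $0$. Initially each agent knows its own id and private input (including its preference), but not those of other agents. Private information comes from a finite set, and each agent's prior over the private information of the others is uniform. **Outputs and utilities.** Agent $a$ outputs $o_a$ ($\bot$ means it aborts). Output vectors are $O=(o_1,\dots,o_n)\in\Theta=\Theta_L\sqcup\Theta_E$, where $\Theta_L$ is the set of legal and $\Theta_E$ the set of erroneous output vectors. Each agent $a$ has a single preferred output value $p_a$ and utility $u_a(O)=1$ if $o_a=p_a$ and $O\in\Theta_L$, and $u_a(O)=0$ otherwise. An agent that detects that another agent deviated outputs $\bot$, which makes the output erroneous. **Equilibrium.** For a step $s$ (the entire operation of an agent in one round: random choices, computation, messages) of agent $a$ at round $r$ of an execution, $\mathbb{E}_{s,r}[u_a]=\sum_{O\in\Theta}x_O(s,r)u_a(O)$, where $x_O(s,r)$ is the probability, estimated by $a$ at round $r$, that $O$ is output if $a$ takes step $s$ and all other agents follow the algorithm. An algorithm $\Lambda$ whose next step at round $r$ is $s(r)$ is a (distributed) equilibrium if for every agent $a$, every round $r$ of every possible execution in which all steps up to round $r$ were according to $\Lambda$,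 and every deviating step $\bar s$: $\mathbb{E}_{s(r),r}[u_a]\ge \mathbb{E}_{\bar s,r}[u_a]$. Only a single agent deviates (no coalitions). **Duplication (Sybil attack).** A deviating agent may pretend to be $d$ agents, by simulating $d$ imaginary agents with fake ids and distributing its edges among them. The other agents then execute the algorithm as if on the enlarged graph, of size $n'=n+d-1$. The id space is much larger than $n$, so collisions of fake ids with existing ids are disregarded. The cheater still produces a single output, and legality is judged on the output vector of the $n$ real agents. **Knowledge Sharing.** Each agent $a$ has a private input $i_a$; all agents have the same function $q$ and know its output space. An output vector is legal iff all agents output the same value $\neq\bot$. The output is correct if every agent outputs $q(I)$, with $I=\{i_1,\dots,i_n\}$ the inputs of all agents. The function $q$ satisfies the Full Knowledge property: for any number $m$ of inputs, any $1\le j\le m$ and any fixed $(x_1,\dots,x_{j-1},x_{j+1},\dots,x_m)$, the number $z_y=|\{x_j : q(x_1,\dots,x_j,\dots,x_m)=y\}|$ is the same for every $y$ in the range of $q$ (inputs being uniform). A protocol for Knowledge Sharing solves the problem for every possible $k=|\mathrm{range}(q)|$, and it is an equilibrium if for any possible $k$ no agent has an incentive to cheat. Each agent $a$ prefers a certain output value $p_a$. **Secret-Transmit$(i_a,r,b)$** (in a ring). Agent $a$ selects a random number $R_a$ and sets $X_a=R_a\oplus i_a$. It sends $R_a$ clockwise and $X_a$ counter-clockwise, each being forwarded until it reaches the agent just before $b$. At round $r-1$ the two neighbors of $b$ simultaneously send these two values to $b$, so $b$ learns $i_a$ at round $r$. **Protocol "Knowledge Sharing in a Ring".** (1) All agents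 execute Wake-Up, a preliminary phase after which every agent knows the ids of all agents and the size $n'$ of the ring (possibly including duplicated agents). (2) For each agent $a$ let $b^1_a$ be the clockwise neighbor of $a$ and $b^2_a$ the agent at distance $\lfloor n'/2\rfloor$ counter-clockwise from $a$. (3) Each agent $a$ simultaneously performs Secret-Transmit$(i_a,n',b^1_a)$ and Secret-Transmit$(i_a,n',b^2_a)$. (4) At round $n'+1$ each agent sends its input around the ring. (5) At round $2n'$ each agent outputs $q(I)$. *)

theory Defs
  imports "HOL-Probability.Probability" "HOL-Library.Word"
begin

section \<open>Synchronous execution on an oriented ring\<close>

text \<open>
  The real agents are \<open>0, \<dots>, n - 1\<close>, and \<open>(j + 1) mod n\<close> is the clockwise neighbour of \<open>j\<close>.
  In every round each agent sends one message over each of its two edges.  What it has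
  received by the beginning of round \<open>t\<close> is a list of length \<open>t\<close>: entry \<open>s\<close> holds the messages
  sent to it in round \<open>s\<close>, first the one that arrives from its counter-clockwise neighbour
  (and so travels clockwise), then the one from its clockwise neighbour.  The current round is
  the length of the list.
\<close>

type_synonym 'm history = "('m \<times> 'm) list"

text \<open>
  The function \<open>send\<close> gives the clockwise and the counter-clockwise message; \<open>decide\<close> gives
  the output, where \<open>None\<close> stands for \<open>\<bottom>\<close>.
\<close>

datatype ('m, 'y) behaviour =
  Behaviour (send: "'m history \<Rightarrow> 'm \<times> 'm") (decide: "'m history \<Rightarrow> 'y option")

primrec received :: "nat \<Rightarrow> (nat \<Rightarrow> ('m, 'y) behaviour) \<Rightarrow> nat \<Rightarrow> nat \<Rightarrow> 'm history" where
  "received n B 0 = (\<lambda>j. [])"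
| "received n B (Suc t) = (\<lambda>j.
     let l = (j + n - 1) mod n; r = (j + 1) mod n
     in received n B t j @
          [(fst (send (B l) (received n B t l)), snd (send (B r) (received n B t r)))])"

definition outputs :: "nat \<Rightarrow> (nat \<Rightarrow> ('m, 'y) behaviour) \<Rightarrow> nat \<Rightarrow> 'y option list" where
  "outputs n B T = map (\<lambda>j. decide (B j) (received n B T j)) [0..<n]"

text \<open>
  A ring algorithm as it runs after Wake-Up.  \<open>program A L x c\<close> is the behaviour of an agent
  with input \<open>x\<close> and random choices \<open>c\<close> (drawn from \<open>coins A\<close> in round 0) to which Wake-Up
  has reported the list \<open>L\<close> of all ids in clockwise order, starting with its own.  On a ring
  of (apparent) size \<open>m\<close> the outputs are produced in round \<open>duration A m\<close>; the rounds are
  counted from the end of Wake-Up.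
\<close>

record ('x, 'c, 'm, 'y) algorithm =
  coins :: "'c pmf"
  duration :: "nat \<Rightarrow> nat"
  program :: "nat list \<Rightarrow> 'x \<Rightarrow> 'c \<Rightarrow> ('m, 'y) behaviour"


section \<open>Utilities and equilibria\<close>

definition legal :: "'y option list \<Rightarrow> bool" where
  "legal Os \<longleftrightarrow> (\<exists>y. \<forall>v \<in> set Os. v = Some y)"

definition utility :: "nat \<Rightarrow> 'y \<Rightarrow> 'y option list \<Rightarrow> real" where
  "utility a y Os = (if Os ! a = Some y \<and> legal Os then 1 else 0)"

definition expected_utility :: "nat \<Rightarrow> 'y \<Rightarrow> 'y option list pmf \<Rightarrow> real" where
  "expected_utility a y X = measure_pmf.expectation X (utility a y)"

text \<open>A world consists of the inputs and the random choices of the real agents.\<close>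

type_synonym ('x, 'c) world = "(nat \<Rightarrow> 'x) \<times> (nat \<Rightarrow> 'c)"

definition prior ::
    "('x, 'c, 'm, 'y) algorithm \<Rightarrow> nat \<Rightarrow> 'x set \<Rightarrow> ('x, 'c) world pmf" where
  "prior A n D =
     pair_pmf (Pi_pmf {..<n} undefined (\<lambda>_. pmf_of_set D)) (Pi_pmf {..<n} undefined (\<lambda>_. coins A))"

text \<open>All agents follow the algorithm; \<open>ids ! j\<close> is the id of agent \<open>j\<close>.\<close>

definition honest_profile ::
    "('x, 'c, 'm, 'y) algorithm \<Rightarrow> nat list \<Rightarrow> ('x, 'c) world \<Rightarrow> nat \<Rightarrow> ('m, 'y) behaviour" where
  "honest_profile A ids \<omega> j = program A (rotate j ids) (fst \<omega> j) (snd \<omega> j)"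

text \<open>
  What agent \<open>a\<close> knows when it takes its step of round \<open>r\<close> of an honest execution.  Its own
  random choices are part of the step of round 0, so they are not known before that step.
\<close>

definition view ::
    "('x, 'c, 'm, 'y) algorithm \<Rightarrow> nat list \<Rightarrow> nat \<Rightarrow> nat \<Rightarrow> ('x, 'c) world
      \<Rightarrow> 'x \<times> 'c option \<times> 'm history" where
  "view A ids a r \<omega> =
     (fst \<omega> a, if r = 0 then None else Some (snd \<omega> a),
      received (length ids) (honest_profile A ids \<omega>) r a)"

definition posterior ::
    "('x, 'c, 'm, 'y) algorithm \<Rightarrow> nat list \<Rightarrow> 'x set \<Rightarrow> nat \<Rightarrow> nat \<Rightarrow> ('x, 'c) world
      \<Rightarrow> ('x, 'c) world pmf" where
  "posterior A ids D a r \<omega>\<^sub>0 =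
     cond_pmf (prior A (length ids) D) {\<omega>. view A ids a r \<omega> = view A ids a r \<omega>\<^sub>0}"

definition honest_outcome ::
    "('x, 'c, 'm, 'y) algorithm \<Rightarrow> nat list \<Rightarrow> ('x, 'c) world pmf \<Rightarrow> 'y option list pmf" where
  "honest_outcome A ids W =
     map_pmf (\<lambda>\<omega>. outputs (length ids) (honest_profile A ids \<omega>) (duration A (length ids))) W"

definition deviate_from ::
    "nat \<Rightarrow> ('m, 'y) behaviour \<Rightarrow> ('m, 'y) behaviour \<Rightarrow> ('m, 'y) behaviour" where
  "deviate_from r B B' =
     Behaviour (\<lambda>h. if length h < r then send B h else send B' h) (decide B')"

text \<open>
  Agent \<open>a\<close> follows the algorithm before round \<open>r\<close> and from then on behaves arbitrarily,
  choosing its behaviour at random from \<open>S\<close>; all others follow the algorithm throughout.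
\<close>

definition deviation_outcome ::
    "('x, 'c, 'm, 'y) algorithm \<Rightarrow> nat list \<Rightarrow> nat \<Rightarrow> nat \<Rightarrow> ('m, 'y) behaviour pmf
      \<Rightarrow> ('x, 'c) world pmf \<Rightarrow> 'y option list pmf" where
  "deviation_outcome A ids a r S W =
     map_pmf (\<lambda>(\<omega>, B). let H = honest_profile A ids \<omega>
                       in outputs (length ids) (H(a := deviate_from r (H a) B))
                            (duration A (length ids)))
       (pair_pmf W S)"

text \<open>
  Duplication.  In Wake-Up agent \<open>a\<close> pretends to be \<open>length F\<close> agents with the ids \<open>F\<close> (in
  clockwise order), so Wake-Up reports the enlarged ring to all others, who then execute the
  algorithm on that ring.  The communication takes place on the real ring of \<open>length ids\<close>
  agents: the two edges of \<open>a\<close> are the only edges that leave the imaginary segment, and the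
  behaviour of \<open>a\<close> on these edges is arbitrary (in particular it may simulate \<open>length F\<close>
  agents).  Agent \<open>a\<close> has a single output.
\<close>

definition enlarged_ring :: "nat list \<Rightarrow> nat \<Rightarrow> nat list \<Rightarrow> nat list" where
  "enlarged_ring ids a F = take a ids @ F @ drop (Suc a) ids"

definition enlarged_position :: "nat \<Rightarrow> nat \<Rightarrow> nat \<Rightarrow> nat" where
  "enlarged_position a d j = (if j \<le> a then j else j + d - 1)"

definition duplication_profile ::
    "('x, 'c, 'm, 'y) algorithm \<Rightarrow> nat list \<Rightarrow> nat \<Rightarrow> nat list \<Rightarrow> ('m, 'y) behaviour
      \<Rightarrow> ('x, 'c) world \<Rightarrow> nat \<Rightarrow> ('m, 'y) behaviour" where
  "duplication_profile A ids a F B \<omega> j =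
     (if j = a then B
      else program A (rotate (enlarged_position a (length F) j) (enlarged_ring ids a F))
             (fst \<omega> j) (snd \<omega> j))"

definition duplication_outcome ::
    "('x, 'c, 'm, 'y) algorithm \<Rightarrow> nat list \<Rightarrow> nat \<Rightarrow> nat list \<Rightarrow> ('m, 'y) behaviour pmf
      \<Rightarrow> ('x, 'c) world pmf \<Rightarrow> 'y option list pmf" where
  "duplication_outcome A ids a F S W =
     map_pmf (\<lambda>(\<omega>, B). outputs (length ids) (duplication_profile A ids a F B \<omega>)
                         (duration A (length (enlarged_ring ids a F))))
       (pair_pmf W S)"

text \<open>
  Equilibrium against deviations in which the cheater pretends to be at most \<open>dmax\<close> agents.
  The execution reached so far is given by the actual world \<open>\<omega>\<^sub>0\<close>.  The first part concerns
  deviations that start in a round \<open>r\<close> after an honest Wake-Up, the second part those that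
  start in Wake-Up, when the agent knows no more than at the beginning of round 0.  The
  behaviour after the deviating step is arbitrary as well, so both parts cover deviations
  consisting of a single step.
\<close>

definition equilibrium_upto ::
    "nat \<Rightarrow> ('x, 'c, 'm, 'y) algorithm \<Rightarrow> nat list \<Rightarrow> 'x set \<Rightarrow> (nat \<Rightarrow> 'y) \<Rightarrow> bool" where
  "equilibrium_upto dmax A ids D pref \<longleftrightarrow>
     (\<forall>a < length ids. \<forall>\<omega>\<^sub>0 \<in> set_pmf (prior A (length ids) D).
        (\<forall>r \<le> duration A (length ids). \<forall>S.
           let W = posterior A ids D a r \<omega>\<^sub>0
           in expected_utility a (pref a) (honest_outcome A ids W)
                \<ge> expected_utility a (pref a) (deviation_outcome A ids a r S W)) \<and>
        (\<forall>F S. F \<noteq> [] \<and> length F \<le> dmax \<and> distinct (enlarged_ring ids a F) \<longrightarrow>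
           (let W = posterior A ids D a 0 \<omega>\<^sub>0
            in expected_utility a (pref a) (honest_outcome A ids W)
                 \<ge> expected_utility a (pref a) (duplication_outcome A ids a F S W))))"


section \<open>Knowledge Sharing\<close>

text \<open>
  The function \<open>q\<close> takes the list of all inputs, in a common order on which all agents agree:
  by increasing id.
\<close>

definition q_range :: "'x set \<Rightarrow> ('x list \<Rightarrow> 'y) \<Rightarrow> 'y set" where
  "q_range D q = q ` {xs. xs \<noteq> [] \<and> set xs \<subseteq> D}"

definition full_knowledge :: "'x set \<Rightarrow> ('x list \<Rightarrow> 'y) \<Rightarrow> bool" where
  "full_knowledge D q \<longleftrightarrow>
     (\<forall>xs j. set xs \<subseteq> D \<and> j < length xs \<longrightarrow>
        (\<forall>y \<in> q_range D q. \<forall>y' \<in> q_range D q.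
           card {x \<in> D. q (xs[j := x]) = y} = card {x \<in> D. q (xs[j := x]) = y'}))"

definition solves_knowledge_sharing ::
    "('x, 'c, 'm, 'y) algorithm \<Rightarrow> nat list \<Rightarrow> 'x set \<Rightarrow> ('x list \<Rightarrow> 'y) \<Rightarrow> bool" where
  "solves_knowledge_sharing A ids D q \<longleftrightarrow>
     (let n = length ids
      in \<forall>\<omega> \<in> set_pmf (prior A n D).
           outputs n (honest_profile A ids \<omega>) (duration A n) =
             replicate n (Some (q (map (fst \<omega>) (sort_key (\<lambda>j. ids ! j) [0..<n])))))"


section \<open>The protocol\<close>

text \<open>
  \<open>B1\<close> and \<open>B2\<close> distinguish the two recipients \<open>b\<^sup>1\<close> and \<open>b\<^sup>2\<close> of an agent's secret.  A
  message is a set of values labelled by their origin: \<open>Rand o k\<close> is the \<open>R\<close>-part and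
  \<open>Masked o k\<close> the \<open>X\<close>-part of the transmission of agent \<open>o\<close> to its \<open>k\<close>-th recipient, and
  \<open>Input o\<close> is the input of \<open>o\<close>.
\<close>

datatype recipient = B1 | B2

datatype label = Rand nat recipient | Masked nat recipient | Input nat

type_synonym 'w message = "label \<Rightarrow> 'w option"

text \<open>Ids of the agents at a given clockwise or counter-clockwise distance, for an agent with list \<open>L\<close>\<close>

definition cw :: "nat list \<Rightarrow> nat \<Rightarrow> nat" where
  "cw L s = L ! (s mod length L)"

definition ccw :: "nat list \<Rightarrow> nat \<Rightarrow> nat" where
  "ccw L s = L ! ((length L - s mod length L) mod length L)"

text \<open>Distances from an agent to its recipients on a ring of size \<open>m\<close>\<close>

fun ccw_dist :: "nat \<Rightarrow> recipient \<Rightarrow> nat" where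
  "ccw_dist m B1 = m - 1"
| "ccw_dist m B2 = m div 2"

definition cw_dist :: "nat \<Rightarrow> recipient \<Rightarrow> nat" where
  "cw_dist m k = m - ccw_dist m k"

text \<open>
  Round in which the agent at distance \<open>s\<close> from the origin passes on a part destined for the
  agent at distance \<open>c > s\<close>: at once, except that the last agent before the recipient waits
  until round \<open>m - 1\<close>.
\<close>

definition transmit_round :: "nat \<Rightarrow> nat \<Rightarrow> nat \<Rightarrow> nat" where
  "transmit_round m c s = (if s + 1 < c then s else m - 1)"

text \<open>
  Labels of the values that an agent has to send clockwise and counter-clockwise in round
  \<open>t\<close>.  The inputs go around the ring clockwise, starting in round \<open>m + 1\<close>, and so reach the
  last agent in round \<open>2 * m\<close>.
\<close>

definition cw_labels :: "nat list \<Rightarrow> nat \<Rightarrow> label set" where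
  "cw_labels L t =
     (let m = length L
      in {Rand (ccw L s) k | s k. s < cw_dist m k \<and> transmit_round m (cw_dist m k) s = t}
         \<union> {Input (ccw L s) | s. s + 1 < m \<and> m + 1 + s = t})"

definition ccw_labels :: "nat list \<Rightarrow> nat \<Rightarrow> label set" where
  "ccw_labels L t =
     (let m = length L
      in {Masked (cw L s) k | s k. s < ccw_dist m k \<and> transmit_round m (ccw_dist m k) s = t})"

fun coin :: "'w \<times> 'w \<Rightarrow> recipient \<Rightarrow> 'w" where
  "coin c B1 = fst c"
| "coin c B2 = snd c"

definition own_values ::
    "nat list \<Rightarrow> 'l::len word \<Rightarrow> 'l word \<times> 'l word \<Rightarrow> 'l word message" where
  "own_values L x c = (\<lambda>l. case l of
       Rand i k \<Rightarrow> if i = hd L then Some (coin c k) else None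
     | Masked i k \<Rightarrow> if i = hd L then Some (xor (coin c k) x) else None
     | Input i \<Rightarrow> if i = hd L then Some x else None)"

definition known_values ::
    "nat list \<Rightarrow> 'l::len word \<Rightarrow> 'l word \<times> 'l word \<Rightarrow> 'l word message history \<Rightarrow> 'l word message" where
  "known_values L x c h = foldl (\<lambda>K (u, v). K ++ u ++ v) (own_values L x c) h"

text \<open>Every message received so far carried exactly the values it had to carry.\<close>

definition well_formed :: "nat list \<Rightarrow> 'w message history \<Rightarrow> bool" where
  "well_formed L h \<longleftrightarrow>
     (\<forall>t < length h.
        dom (fst (h ! t)) = cw_labels (rotate (length L - 1) L) t \<and>
        dom (snd (h ! t)) = ccw_labels (rotate 1 L) t)"

text \<open>
  The inputs announced in the last phase are possible ones, and those of the agents that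
  have sent their secret to this agent agree with these secrets.
\<close>

definition consistent :: "'l::len word set \<Rightarrow> nat list \<Rightarrow> 'l word message \<Rightarrow> bool" where
  "consistent D L K \<longleftrightarrow>
     (\<forall>i \<in> set L. the (K (Input i)) \<in> D) \<and>
     (\<forall>k. let i = ccw L (cw_dist (length L) k)
          in xor (the (K (Rand i k))) (the (K (Masked i k))) = the (K (Input i)))"

definition ring_program ::
    "'l::len word set \<Rightarrow> ('l word list \<Rightarrow> 'y) \<Rightarrow> nat list \<Rightarrow> 'l word \<Rightarrow> 'l word \<times> 'l word
      \<Rightarrow> ('l word message, 'y) behaviour" where
  "ring_program D q L x c =
     Behaviour
       (\<lambda>h. let K = known_values L x c h
            in (K |` cw_labels L (length h), K |` ccw_labels L (length h)))
       (\<lambda>h. let K = known_values L x c h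
            in if well_formed L h \<and> consistent D L K
               then Some (q (map (\<lambda>i. the (K (Input i))) (sort L)))
               else None)"

definition knowledge_sharing_in_ring ::
    "'l::len word set \<Rightarrow> ('l word list \<Rightarrow> 'y)
      \<Rightarrow> ('l word, 'l word \<times> 'l word, 'l word message, 'y) algorithm" where
  "knowledge_sharing_in_ring D q =
     \<lparr>coins = pmf_of_set UNIV, duration = (\<lambda>m. 2 * m), program = ring_program D q\<rparr>"

end

theory Submission
  imports Defs
begin

text \<open>
  Before round \<open>m - 1\<close> of the protocol on an (apparent) ring of size \<open>m\<close>,
  the cheater has seen at most one share of each of the two transmissions of its real
  counter-clockwise neighbour: the recipient \<open>b\<^sup>1\<close> of that agent is the first
  agent of the cheater's segment, to which the random share goes only in round \<open>m - 1\<close>,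
  and, since the segment has at most \<open>n\<close> agents, the recipient \<open>b\<^sup>2\<close>
  is either an honest agent or the last agent of the segment. Hence replacing the input of this
  neighbour, with its coins adjusted accordingly, changes nothing that the cheater sees before it
  sends its last shares. Conversely every agent of the segment has an honest recipient, which
  compares the announced input with the shares it has got by round \<open>m\<close>; so the
  announced inputs of the segment are fixed independently of the neighbour's input. The
  counter-clockwise real neighbour receives all honest inputs along honest agents only, so a
  unanimous output is \<open>q\<close> of the true honest inputs and these fixed inputs. By full
  knowledge, averaging over the neighbour's input gives every value of \<open>q\<close> the same
  probability as an honest execution does. After round \<open>n - 1\<close> of an honest execution
  the cheater's own input is fixed as well, and a deviation can only destroy the unanimity.
\<close>

section \<open>Labels and histories on a rotated ring\<close>

text \<open>Reflecting \<open>s\<close> to \<open>u - s\<close> is an involution on the residues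
  modulo \<open>m\<close>; the summand \<open>m\<close> keeps the subtraction from truncating. It
  converts the position of an origin into a distance and back.\<close>

lemma mod_index_iff:
  fixes u m s i :: nat
  assumes "s < m" "i < m"
  shows "(u + m - s) mod m = i \<longleftrightarrow> s = (u + m - i) mod m"
proof -
  define v where "v = u mod m"
  have v: "v < m" using assms v_def by simp
  have "(u + m - k) mod m = (v + m - k) mod m" if "k < m" for k
  proof -
    have "(u + (m - k)) mod m = (v + (m - k)) mod m"
      unfolding v_def by (simp add: mod_add_left_eq)
    then show ?thesis using that by simp
  qed
  then have e: "(u + m - s) mod m = (v + m - s) mod m" "(u + m - i) mod m = (v + m - i) mod m"
    using assms by auto
  have m: "(v + m - k) mod m = (if k \<le> v then v - k else v + m - k)" if "k < m" for k
  proof (cases "k \<le> v")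
    case True
    then have "v + m - k = (v - k) + m" by simp
    then show ?thesis using True v by (metis mod_add_self2 mod_less less_imp_diff_less)
  next
    case False
    then show ?thesis using v by simp
  qed
  show ?thesis unfolding e m[OF assms(1)] m[OF assms(2)] using assms v by auto
qed

lemma add_mod_cases:
  fixes a u n :: nat
  assumes "a < n" "u < n"
  shows "(a + u) mod n = (if a + u < n then a + u else a + u - n)"
  using assms by (simp add: le_mod_geq)

lemma nth_rotate_mod: "0 < length M \<Longrightarrow> rotate u M ! (s mod length M) = M ! ((u + s) mod length M)"
  by (simp add: nth_rotate mod_add_right_eq)

lemma ccw_rotate:
  assumes "s < length M"
  shows "ccw (rotate u M) s = M ! ((u + length M - s) mod length M)"
proof -
  have "M \<noteq> []" using assms by auto
  then show ?thesis using assms by (simp add: ccw_def nth_rotate_mod)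
qed

lemma cw_rotate:
  assumes "s < length M"
  shows "cw (rotate u M) s = M ! ((u + s) mod length M)"
proof -
  have "M \<noteq> []" using assms by auto
  then show ?thesis by (simp add: cw_def nth_rotate_mod)
qed

lemma cw_dist_less: "2 \<le> m \<Longrightarrow> cw_dist m k < m"
  by (cases k) (auto simp: cw_dist_def)

lemma cw_dist_pos: "2 \<le> m \<Longrightarrow> 0 < cw_dist m k"
  by (cases k) (auto simp: cw_dist_def)

lemma ccw_dist_less: "2 \<le> m \<Longrightarrow> ccw_dist m k < m"
  by (cases k) auto

lemma ccw_dist_pos: "2 \<le> m \<Longrightarrow> 0 < ccw_dist m k"
  by (cases k) auto

text \<open>Ids are distinct, so a label determines the position \<open>i\<close> of its origin and
  with it the clockwise distance \<open>s\<close> to position \<open>u\<close>. Hence each agent has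
  at most one round in which a given label is due.\<close>

lemma Rand_in_cw_labels_iff:
  assumes "distinct M" "i < length M" "2 \<le> length M" "m = length M"
  shows "Rand (M ! i) k \<in> cw_labels (rotate u M) t \<longleftrightarrow>
    (let s = (u + m - i) mod m in s < cw_dist m k \<and> transmit_round m (cw_dist m k) s = t)"
proof -
  have *: "ccw (rotate u M) s = M ! i \<longleftrightarrow> s = (u + m - i) mod m" if "s < cw_dist m k" for s
  proof -
    have "s < m" using that cw_dist_less[of m k] assms by simp
    moreover have "M \<noteq> []" using assms by auto
    ultimately show ?thesis
      using assms mod_index_iff[of s m i u] by (simp add: ccw_rotate nth_eq_iff_index_eq)
  qed
  then show ?thesis
    unfolding cw_labels_def Let_def using assms(4) by (auto simp: eq_commute[of "M ! i"])
qed

lemma Input_in_cw_labels_iff: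
  assumes "distinct M" "i < length M" "m = length M"
  shows "Input (M ! i) \<in> cw_labels (rotate u M) t \<longleftrightarrow>
    (let s = (u + m - i) mod m in s + 1 < m \<and> m + 1 + s = t)"
proof -
  have *: "ccw (rotate u M) s = M ! i \<longleftrightarrow> s = (u + m - i) mod m" if "s + 1 < m" for s
  proof -
    have "s < m" using that by simp
    moreover have "M \<noteq> []" using assms by auto
    ultimately show ?thesis
      using assms mod_index_iff[of s m i u] by (simp add: ccw_rotate nth_eq_iff_index_eq)
  qed
  then show ?thesis
    unfolding cw_labels_def Let_def using assms(3) by (auto simp: eq_commute[of "M ! i"])
qed

lemma Masked_in_ccw_labels_iff:
  assumes "distinct M" "i < length M" "2 \<le> length M" "m = length M" "u \<le> m"
  shows "Masked (M ! i) k \<in> ccw_labels (rotate u M) t \<longleftrightarrow>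
    (let s = (i + m - u) mod m in s < ccw_dist m k \<and> transmit_round m (ccw_dist m k) s = t)"
proof -
  have *: "cw (rotate u M) s = M ! i \<longleftrightarrow> s = (i + m - u) mod m" if "s < ccw_dist m k" for s
  proof -
    have s: "s < m" using that ccw_dist_less[of m k] assms by simp
    have i: "i < m" using assms by simp
    have "(u + s) mod m = i \<longleftrightarrow> s = (i + m - u) mod m"
    proof (cases "u = m")
      case True
      then show ?thesis using s i by auto
    next
      case False
      then have u: "u < m" using assms by simp
      have "(i + m - u) mod m = (if u \<le> i then i - u else i + m - u)"
      proof (cases "u \<le> i")
        case True
        then have "i + m - u = (i - u) + m" by simp
        then show ?thesis using True i by (metis mod_add_self2 mod_less less_imp_diff_less)
      next
        case False
        then show ?thesis using u i by simp
      qed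
      moreover have "(u + s) mod m = (if u + s < m then u + s else u + s - m)"
        using u s by (simp add: mod_if)
      ultimately show ?thesis using u s i by auto
    qed
    moreover have "M \<noteq> []" using assms by auto
    ultimately show ?thesis
      using assms s by (simp add: cw_rotate nth_eq_iff_index_eq)
  qed
  then show ?thesis
    unfolding ccw_labels_def Let_def using assms(4) by (auto simp: eq_commute[of "M ! i"])
qed

lemma not_in_cw_labels [simp]: "Masked o' k \<notin> cw_labels L t"
  by (auto simp: cw_labels_def Let_def)

lemma not_in_ccw_labels [simp]: "Rand o' k \<notin> ccw_labels L t" "Input o' \<notin> ccw_labels L t"
  by (auto simp: ccw_labels_def Let_def)

lemma transmit_round_less: "c < m \<Longrightarrow> s < c \<Longrightarrow> transmit_round m c s < m"
  by (auto simp: transmit_round_def)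

lemma Rand_in_cw_labelsD: 
  assumes "Rand i k \<in> cw_labels L t" "2 \<le> length L" shows "t < length L"
  using assms cw_dist_less[of "length L" k] 
  by (auto simp: cw_labels_def Let_def intro: transmit_round_less)

lemma Masked_in_ccw_labelsD: 
  assumes "Masked i k \<in> ccw_labels L t" "2 \<le> length L" shows "t < length L"
  using assms ccw_dist_less[of "length L" k] 
  by (auto simp: ccw_labels_def Let_def intro: transmit_round_less)

lemma Input_in_cw_labelsD: 
  assumes "Input i \<in> cw_labels L t" shows "length L < t"
  using assms by (auto simp: cw_labels_def Let_def)

section \<open>Histories and accumulated knowledge\<close>

lemma length_received [simp]: "length (received n B t j) = t"
  by (induction t arbitrary: j) (auto simp: Let_def)

lemma take_received: "s \<le> t \<Longrightarrow> take s (received n B t j) = received n B s j"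
proof (induction t)
  case (Suc t)
  then show ?case by (cases "s = Suc t") (auto simp: Let_def)
qed auto

lemma nth_received:
  "s < t \<Longrightarrow> received n B t j ! s =
     (fst (send (B ((j + n - 1) mod n)) (received n B s ((j + n - 1) mod n))),
      snd (send (B ((j + 1) mod n)) (received n B s ((j + 1) mod n))))"
proof (induction t)
  case (Suc t)
  then show ?case
    by (cases "s = t") (auto simp: Let_def nth_append)
qed auto

lemma known_values_Nil [simp]: "known_values L x c [] = own_values L x c"
  by (simp add: known_values_def)

lemma known_values_snoc [simp]:
  "known_values L x c (h @ [p]) = known_values L x c h ++ fst p ++ snd p"
  by (simp add: known_values_def case_prod_beta)

lemma known_values_take_Suc:
  "t < length h \<Longrightarrow>
    known_values L x c (take (Suc t) h) = known_values L x c (take t h) ++ fst (h ! t) ++ snd (h ! t)"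
  by (simp add: take_Suc_conv_app_nth)

lemma known_values_unchanged:
  assumes "s \<le> t" "t \<le> length h"
    and "\<And>r. s \<le> r \<Longrightarrow> r < t \<Longrightarrow> l \<notin> dom (fst (h ! r)) \<and> l \<notin> dom (snd (h ! r))"
  shows "known_values L x c (take t h) l = known_values L x c (take s h) l"
  using assms
proof (induction t rule: dec_induct)
  case (step t)
  then have "l \<notin> dom (fst (h ! t))" "l \<notin> dom (snd (h ! t))" by auto
  then show ?case using step by (auto simp: known_values_take_Suc map_add_def domIff)
qed auto

text \<open>Executions are invariant under rotating the ring; this later moves the cheater to
  position 0.\<close>

lemma received_rotate:
  assumes "0 < n"
  shows "received n B t ((a + u) mod n) = received n (\<lambda>u. B ((a + u) mod n)) t (u mod n)"
proof (induction t arbitrary: u)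
  case (Suc t)
  have 1: "((a + u) mod n + n - 1) mod n = (a + (u + n - 1)) mod n"
    using assms mod_add_left_eq[of "a + u" n "n - 1"] by (simp add: add.assoc)
  have 2: "((a + u) mod n + 1) mod n = (a + (u + 1)) mod n"
    using mod_add_left_eq[of "a + u" n 1] by (simp add: add.assoc)
  have 3: "(u mod n + n - 1) mod n = (u + n - 1) mod n"
    using assms mod_add_left_eq[of u n "n - 1"] by simp
  have 4: "(u mod n + 1) mod n = (u + 1) mod n"
    using mod_add_left_eq[of u n 1] by simp
  show ?case
    unfolding received.simps Let_def 1 2 3 4 Suc.IH by (simp only: mod_add_right_eq)
qed simp

lemma received_cong:
  assumes "\<And>j. j < n \<Longrightarrow> B j = B' j" "j < n"
  shows "received n B t j = received n B' t j"
  using assms(2)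
proof (induction t arbitrary: j)
  case (Suc t)
  have "(j + n - 1) mod n < n" "(j + 1) mod n < n" using Suc by auto
  then show ?case using Suc assms(1) by (simp add: Let_def)
qed simp

lemma received_deviate_from:
  assumes "t \<le> r"
  shows "received n (H(a := deviate_from r (H a) B)) t j = received n H t j"
  using assms
proof (induction t arbitrary: j)
  case (Suc t)
  then show ?case by (simp add: Let_def deviate_from_def)
qed simp

section \<open>Full knowledge and averaging\<close>

text \<open>The fibres of \<open>q\<close> in coordinate \<open>j\<close> have equal size and
  partition \<open>D\<close>.\<close>

lemma full_knowledge_card:
  assumes fk: "full_knowledge D q" and "finite D" "set xs \<subseteq> D" "j < length xs" 
    and p: "p \<in> q_range D q"
  shows "card {x \<in> D. q (xs[j := x]) = p} * card (q_range D q) = card D"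
proof -
  define N where "N y = {x \<in> D. q (xs[j := x]) = y}" for y
  have ne: "xs[j := x] \<noteq> []" for x using assms by auto
  have sub: "set (xs[j := x]) \<subseteq> D" if "x \<in> D" for x
    using set_update_subset_insert[of xs j x] assms(3) that by blast
  have eq: "card (N y) = card (N p)" if "y \<in> q_range D q" for y
    using fk that assms unfolding full_knowledge_def N_def by blast
  have D: "D = (\<Union>y\<in>q_range D q. N y)"
    unfolding N_def q_range_def using ne sub by blast
  \<comment> \<open>The original entry \<open>xs ! j\<close> makes one fibre nonempty, hence all of
    them; so every value is attained by changing coordinate \<open>j\<close> alone, and
    \<open>q_range D q\<close> is finite.\<close>
  have "xs ! j \<in> D" using assms by auto
  then have "q (xs[j := xs ! j]) \<in> q_range D q" "xs ! j \<in> N (q (xs[j := xs ! j]))"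
    using ne sub[of "xs ! j"] unfolding q_range_def N_def by blast+
  then have "N p \<noteq> {}" using eq \<open>finite D\<close> by (metis N_def card_0_eq card.empty empty_iff finite_subset mem_Collect_eq subsetI)
  then have pos: "card (N p) > 0" using \<open>finite D\<close> by (auto simp: N_def card_gt_0_iff)
  have "q_range D q \<subseteq> (\<lambda>x. q (xs[j := x])) ` D"
  proof
    fix y assume "y \<in> q_range D q"
    then have "card (N y) > 0" using eq pos by simp
    then show "y \<in> (\<lambda>x. q (xs[j := x])) ` D" by (auto simp: card_gt_0_iff N_def)
  qed
  then have fin: "finite (q_range D q)" using \<open>finite D\<close> finite_surj by blast
  have "card D = (\<Sum>y\<in>q_range D q. card (N y))"
    by (subst D, rule card_UN_disjoint) (use fin \<open>finite D\<close> in \<open>auto simp: N_def\<close>)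
  also have "\<dots> = card (N p) * card (q_range D q)" using eq by simp
  finally show ?thesis by (simp add: N_def)
qed

text \<open>\<open>T w y\<close> replaces the \<open>D\<close>-valued coordinate \<open>p w\<close>
  by \<open>y\<close>. Averaging over this coordinate leaves a sum unchanged because
  \<open>(w, y) \<mapsto> (T w y, p w)\<close> is an involution of \<open>W \<times> D\<close>, so a
  comparison for each \<open>w\<close> after averaging suffices.\<close>

lemma sum_le_by_averaging:
  fixes U V :: "'a \<Rightarrow> real"
  assumes "finite W" "finite D" "D \<noteq> {}"
    and TW: "\<And>w y. w \<in> W \<Longrightarrow> y \<in> D \<Longrightarrow> T w y \<in> W"
    and pD: "\<And>w. w \<in> W \<Longrightarrow> p w \<in> D"
    and inv: "\<And>w y. w \<in> W \<Longrightarrow> y \<in> D \<Longrightarrow> T (T w y) (p w) = w"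
    and proj: "\<And>w y. w \<in> W \<Longrightarrow> y \<in> D \<Longrightarrow> p (T w y) = y"
    and le: "\<And>w. w \<in> W \<Longrightarrow> (\<Sum>y\<in>D. U (T w y)) \<le> (\<Sum>y\<in>D. V (T w y))"
  shows "(\<Sum>w\<in>W. U w) \<le> (\<Sum>w\<in>W. V w)"
proof -
  have avg: "real (card D) * (\<Sum>w\<in>W. f w) = (\<Sum>w\<in>W. \<Sum>y\<in>D. f (T w y))" for f :: "'a \<Rightarrow> real"
  proof -
    have "(\<Sum>w\<in>W. \<Sum>y\<in>D. f (T w y)) = (\<Sum>z\<in>W \<times> D. f (T (fst z) (snd z)))"
      by (simp add: sum.cartesian_product case_prod_beta)
    also have "\<dots> = (\<Sum>z\<in>W \<times> D. f (fst z))"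
      by (rule sum.reindex_bij_witness[of _ "\<lambda>(w, y). (T w y, p w)" "\<lambda>(w, y). (T w y, p w)"])
        (auto simp: TW pD inv proj)
    also have "\<dots> = (\<Sum>w\<in>W. \<Sum>y\<in>D. f w)"
      unfolding sum.cartesian_product by (simp add: case_prod_beta)
    finally show ?thesis by (simp add: sum_distrib_left)
  qed
  have "real (card D) * (\<Sum>w\<in>W. U w) \<le> real (card D) * (\<Sum>w\<in>W. V w)"
    unfolding avg by (rule sum_mono) (rule le)
  moreover have "card D > 0" using assms by (simp add: card_gt_0_iff)
  ultimately show ?thesis by simp
qed

section \<open>Labels and distances when moving by one position\<close>

lemma rotate_length_minus_1_rotate: "0 < length M \<Longrightarrow> rotate (length (rotate u M) - 1) (rotate u M) = rotate (u + length M - 1) M"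
  by (cases "length M") (simp_all add: rotate_rotate add.commute)

lemma Masked_in_ccw_labels_iff':
  assumes "distinct M" "i < length M" "2 \<le> length M" "m = length M"
  shows "Masked (M ! i) k \<in> ccw_labels (rotate u M) t \<longleftrightarrow>
    (let s = (i + m - u mod m) mod m in s < ccw_dist m k \<and> transmit_round m (ccw_dist m k) s = t)"
proof -
  have "0 < m" using assms by auto
  then have "u mod m \<le> m" by (simp only: mod_le_divisor)
  then show ?thesis
    using Masked_in_ccw_labels_iff[OF assms, of "u mod m"] assms(4) rotate_conv_mod[of u M] by simp
qed

lemma cw_labels_cases:
  assumes "l \<in> cw_labels (rotate u M) t" "2 \<le> length M"
  obtains i k where "i < length M" "l = Rand (M ! i) k" | i where "i < length M" "l = Input (M ! i)"
proof -
  have 1: "ccw (rotate u M) s \<in> set M" if "s < length M" for s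
  proof -
    have "M \<noteq> []" using that by auto
    then show ?thesis using that by (simp add: ccw_rotate)
  qed
  have "(\<exists>i\<in>set M. \<exists>k. l = Rand i k) \<or> (\<exists>i\<in>set M. l = Input i)"
    using assms cw_dist_less[of "length M"] unfolding cw_labels_def Let_def length_rotate
    by (blast intro: 1 less_trans add_lessD1)
  then show ?thesis using that by (metis in_set_conv_nth)
qed

lemma ccw_labels_cases:
  assumes "l \<in> ccw_labels (rotate u M) t" "2 \<le> length M"
  obtains i k where "i < length M" "l = Masked (M ! i) k"
proof -
  have 1: "cw (rotate u M) s \<in> set M" if "s < length M" for s
  proof -
    have "M \<noteq> []" using that by auto
    then show ?thesis using that by (simp add: cw_rotate)
  qed
  have "(\<exists>i\<in>set M. \<exists>k. l = Masked i k)"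
    using assms ccw_dist_less[of "length M"] unfolding ccw_labels_def Let_def length_rotate
    by (blast intro: 1 less_trans)
  then show ?thesis using that by (metis in_set_conv_nth)
qed

text \<open>Modulo \<open>m\<close>, \<open>u + m - 1\<close> is the counter-clockwise neighbour of
  \<open>u\<close>, one step nearer to the origin \<open>i\<close> of clockwise traffic. This and
  its mirror image are the steps along the path of a message.\<close>

lemma ccw_distance_Suc:
  fixes u m i s :: nat
  assumes "i < m" "(u + m - i) mod m = Suc s"
  shows "(u + m - 1 + m - i) mod m = s"
proof -
  have s: "Suc s < m" using assms by (metis mod_less_divisor gr_zeroI not_less0)
  define d where "d = (u + m - i) div m"
  have "u + m - i = d * m + Suc s" using assms(2) d_def by (metis div_mult_mod_eq)
  then have "u + m - 1 + m - i = s + (d + 1) * m" using assms(1) by simp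
  then show ?thesis using s by (metis Suc_lessD mod_less mod_mult_self1)
qed

lemma cw_distance_Suc:
  fixes u m i s :: nat
  assumes "i < m" "(i + m - u mod m) mod m = Suc s"
  shows "(i + m - (u + 1) mod m) mod m = s"
proof -
  define v where "v = u mod m"
  have v: "v < m" using assms v_def by simp
  have 1: "(u + 1) mod m = (if v + 1 = m then 0 else v + 1)"
    unfolding v_def using assms by (simp add: mod_Suc)
  have 2: "(i + m - v) mod m = (if v \<le> i then i - v else i + m - v)"
  proof (cases "v \<le> i")
    case True
    then have "i + m - v = (i - v) + m" by simp
    then show ?thesis using True assms by (metis mod_add_self2 mod_less less_imp_diff_less)
  next
    case False
    then show ?thesis using v by simp
  qed
  have 3: "i + m - v = i - v + m" if "v \<le> i" using that by simp
  show ?thesis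
  proof (cases "v + 1 = m")
    case True
    then show ?thesis using 1 2 assms v_def by (auto split: if_splits)
  next
    case False
    have "(i + m - (v + 1)) mod m = s"
    proof (cases "v \<le> i")
      case True
      then have "i - v = Suc s" using 2 assms v_def by simp
      then have "i + m - (v + 1) = s + m" "s < m" using assms by auto
      then show ?thesis by simp
    next
      case F: False
      then have "i + m - v = Suc s" using 2 assms v_def by simp
      then show ?thesis using F by simp
    qed
    then show ?thesis using 1 False by simp
  qed
qed

lemma own_values_rotate:
  assumes "distinct M" "i < length M"
  shows "own_values (rotate u M) x c (Rand (M ! i) k) =
           (if i = u mod length M then Some (coin c k) else None)"
    and "own_values (rotate u M) x c (Masked (M ! i) k) =
           (if i = u mod length M then Some (xor (coin c k) x) else None)"
    and "own_values (rotate u M) x c (Input (M ! i)) =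
           (if i = u mod length M then Some x else None)"
proof -
  have "M \<noteq> []" using assms by auto
  then have "M ! i = hd (rotate u M) \<longleftrightarrow> i = u mod length M"
    using assms by (simp add: hd_rotate_conv_nth nth_eq_iff_index_eq)
  then show "own_values (rotate u M) x c (Rand (M ! i) k) =
           (if i = u mod length M then Some (coin c k) else None)"
    "own_values (rotate u M) x c (Masked (M ! i) k) =
           (if i = u mod length M then Some (xor (coin c k) x) else None)"
    "own_values (rotate u M) x c (Input (M ! i)) =
           (if i = u mod length M then Some x else None)"
    by (auto simp: own_values_def)
qed

text \<open>Inputs and coins are indexed by position in \<open>M\<close>. The list may be longer
  than the number of agents that run, so it also serves for the honest part of an enlarged
  ring.\<close>

definition ring_profile ::
    "'l::len word set \<Rightarrow> ('l word list \<Rightarrow> 'y) \<Rightarrow> nat list \<Rightarrow> (nat \<Rightarrow> 'l word)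
      \<Rightarrow> (nat \<Rightarrow> 'l word \<times> 'l word) \<Rightarrow> nat \<Rightarrow> ('l word message, 'y) behaviour" where
  "ring_profile D q M x c u = ring_program D q (rotate u M) (x u) (c u)"

definition knowledge ::
    "nat list \<Rightarrow> (nat \<Rightarrow> 'l::len word) \<Rightarrow> (nat \<Rightarrow> 'l word \<times> 'l word) \<Rightarrow> nat
      \<Rightarrow> 'l word message history \<Rightarrow> 'l word message" where
  "knowledge M x c u h = known_values (rotate u M) (x u) (c u) h"

lemma send_ring_profile:
  "send (ring_profile D q M x c u) h =
     (knowledge M x c u h |` cw_labels (rotate u M) (length h),
      knowledge M x c u h |` ccw_labels (rotate u M) (length h))"
  by (simp add: ring_profile_def ring_program_def knowledge_def Let_def)

text \<open>Sorting forgets the rotation, so every agent applies \<open>q\<close> to the inputs in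
  the same order.\<close>

lemma decide_ring_profile:
  "decide (ring_profile D q M x c u) h =
     (if well_formed (rotate u M) h \<and> consistent D (rotate u M) (knowledge M x c u h)
      then Some (q (map (\<lambda>i. the (knowledge M x c u h (Input i))) (sort M))) else None)"
proof -
  let ?k = "u mod length M"
  have "mset (rotate u M) = mset (take ?k M @ drop ?k M)"
    by (simp only: rotate_drop_take mset_append add.commute)
  then have "sort (rotate u M) = sort M"
    by (intro properties_for_sort) simp_all
  then show ?thesis by (simp add: ring_profile_def ring_program_def knowledge_def Let_def)
qed

section \<open>Honest executions\<close>

locale honest_ring =
  fixes D :: "'l::len word set" and q :: "'l word list \<Rightarrow> 'y" and M :: "nat list"
    and x :: "nat \<Rightarrow> 'l word" and c :: "nat \<Rightarrow> 'l word \<times> 'l word"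
  assumes dist: "distinct M" and len: "2 \<le> length M"
begin

abbreviation n :: nat where "n \<equiv> length M"

text \<open>Reducing \<open>u\<close> modulo \<open>n\<close> lets \<open>u + n - 1\<close> and
  \<open>u + 1\<close> denote the neighbours without a case of wrapping around.\<close>

definition H :: "nat \<Rightarrow> nat \<Rightarrow> 'l word message history" where
  "H t u = received n (ring_profile D q M x c) t (u mod n)"

definition K :: "nat \<Rightarrow> nat \<Rightarrow> 'l word message" where
  "K t u = knowledge M x c (u mod n) (H t u)"

lemma mod_less_n [simp]: "u mod n < n" using len by (simp only: mod_less_divisor)

lemma K_0: "K 0 u = own_values (rotate u M) (x (u mod n)) (c (u mod n))"
  by (simp add: K_def H_def knowledge_def flip: rotate_conv_mod)

lemma H_Suc: "H (Suc t) u = H t u @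
   [(K t (u + n - 1) |` cw_labels (rotate (u + n - 1) M) t,
     K t (u + 1) |` ccw_labels (rotate (u + 1) M) t)]"
proof -
  have 1: "(u mod n + n - 1) mod n = (u + n - 1) mod n"
    using len mod_add_left_eq[of u n "n - 1"] by simp
  have 2: "(u mod n + 1) mod n = (u + 1) mod n"
    by (rule mod_add_left_eq)
  show ?thesis unfolding H_def K_def received.simps Let_def 1 2
    by (simp add: send_ring_profile flip: rotate_conv_mod)
qed

lemma K_Suc: "K (Suc t) u = K t u ++ (K t (u + n - 1) |` cw_labels (rotate (u + n - 1) M) t)
   ++ (K t (u + 1) |` ccw_labels (rotate (u + 1) M) t)"
  unfolding K_def[of "Suc t" u] H_Suc knowledge_def by (simp add: K_def[of t u] knowledge_def)

lemma K_dom_mono: "s \<le> t \<Longrightarrow> dom (K s u) \<subseteq> dom (K t u)"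
  by (induction t rule: dec_induct) (auto simp: K_Suc)

text \<open>Honest agents only copy, so each value ever held stems from some agent's own
  values.\<close>

lemma K_origin:
  "K t u l = Some v \<Longrightarrow> \<exists>i<n. own_values (rotate i M) (x i) (c i) l = Some v"
proof (induction t arbitrary: u)
  case 0
  then show ?case by (metis K_0 mod_less_n rotate_conv_mod)
next
  case (Suc t)
  then have "K t u l = Some v \<or> K t (u + n - 1) l = Some v \<or> K t (u + 1) l = Some v"
    by (auto simp: K_Suc map_add_Some_iff restrict_map_def split: if_splits)
  then show ?case using Suc.IH by blast
qed

lemma K_values:
  assumes "i < n"
  shows "K t u (Rand (M ! i) k) = Some v \<Longrightarrow> v = coin (c i) k"
    and "K t u (Masked (M ! i) k) = Some v \<Longrightarrow> v = xor (coin (c i) k) (x i)"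
    and "K t u (Input (M ! i)) = Some v \<Longrightarrow> v = x i"
  using assms dist by (auto dest!: K_origin simp: own_values_rotate split: if_splits)

lemma own_in_K:
  assumes "i = u mod n"
  shows "Rand (M ! i) k \<in> dom (K t u)" "Masked (M ! i) k \<in> dom (K t u)" "Input (M ! i) \<in> dom (K t u)"
proof -
  have "i < n" using assms by simp
  then have "Rand (M ! i) k \<in> dom (K 0 u)" "Masked (M ! i) k \<in> dom (K 0 u)"
    "Input (M ! i) \<in> dom (K 0 u)"
    using assms dist by (simp_all add: K_0 own_values_rotate domIff)
  then show "Rand (M ! i) k \<in> dom (K t u)" "Masked (M ! i) k \<in> dom (K t u)"
    "Input (M ! i) \<in> dom (K t u)"
    using K_dom_mono[of 0 t u] by blast+
qed

text \<open>What is due in round \<open>t\<close> is either the agent's own (distance 0) or was due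
  one step nearer to the origin in an earlier round, to which strong induction applies.\<close>

lemma labels_known:
  "cw_labels (rotate u M) t \<subseteq> dom (K t u) \<and> ccw_labels (rotate u M) t \<subseteq> dom (K t u)"
proof (induction t arbitrary: u rule: less_induct)
  case (less t)
  have from_left: "l \<in> dom (K t u)" if "l \<in> cw_labels (rotate (u + n - 1) M) s" "s < t" for l s
  proof -
    have "l \<in> dom (K s (u + n - 1))" using less that by blast
    then have "l \<in> dom (K (Suc s) u)" using that by (auto simp: K_Suc)
    then show ?thesis using K_dom_mono[of "Suc s" t u] that by auto
  qed
  have from_right: "l \<in> dom (K t u)" if "l \<in> ccw_labels (rotate (u + 1) M) s" "s < t" for l s
  proof -
    have "l \<in> dom (K s (u + 1))" using less that by blast
    then have "l \<in> dom (K (Suc s) u)" using that by (auto simp: K_Suc)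
    then show ?thesis using K_dom_mono[of "Suc s" t u] that by auto
  qed
  have "l \<in> dom (K t u)" if "l \<in> cw_labels (rotate u M) t" for l
    using that len
  proof (cases rule: cw_labels_cases)
    case (1 i k)
    define s where "s = (u + n - i) mod n"
    have s: "s < cw_dist n k" "transmit_round n (cw_dist n k) s = t"
      using that 1 dist len by (auto simp: Rand_in_cw_labels_iff s_def Let_def)
    show ?thesis
    proof (cases s)
      case 0
      then have "i = u mod n" using mod_index_iff[of 0 n i u] 1 s_def len by fastforce
      then show ?thesis using 1 own_in_K by simp
    next
      case (Suc s')
      then have "(u + n - 1 + n - i) mod n = s'"
        using ccw_distance_Suc[of i n u s'] 1 s_def by simp
      \<comment> \<open>Only the last agent before the recipient holds a part back. The one at
        distance \<open>s'\<close> is not the last, since \<open>s' + 1 = s\<close> is still below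
        \<open>cw_dist n k\<close>, so it forwards in round \<open>s'\<close>.\<close>
      then have "l \<in> cw_labels (rotate (u + n - 1) M) s'"
        using 1 dist len s Suc by (auto simp: Rand_in_cw_labels_iff Let_def transmit_round_def)
      moreover have "s' < t"
        using s Suc cw_dist_less[of n k] len by (auto simp: transmit_round_def split: if_splits)
      ultimately show ?thesis by (rule from_left)
    qed
  next
    case (2 i)
    define s where "s = (u + n - i) mod n"
    have s: "s + 1 < n" "n + 1 + s = t"
      using that 2 dist len by (auto simp: Input_in_cw_labels_iff s_def Let_def)
    show ?thesis
    proof (cases s)
      case 0
      then have "i = u mod n" using mod_index_iff[of 0 n i u] 2 s_def len by fastforce
      then show ?thesis using 2 own_in_K by simp
    next
      case (Suc s')
      then have "(u + n - 1 + n - i) mod n = s'"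
        using ccw_distance_Suc[of i n u s'] 2 s_def by simp
      then have "l \<in> cw_labels (rotate (u + n - 1) M) (n + 1 + s')"
        using 2 dist len s Suc by (auto simp: Input_in_cw_labels_iff Let_def)
      moreover have "n + 1 + s' < t" using s Suc by simp
      ultimately show ?thesis by (rule from_left)
    qed
  qed
  moreover have "l \<in> dom (K t u)" if "l \<in> ccw_labels (rotate u M) t" for l
    using that len
  proof (cases rule: ccw_labels_cases)
    case (1 i k)
    define s where "s = (i + n - u mod n) mod n"
    have s: "s < ccw_dist n k" "transmit_round n (ccw_dist n k) s = t"
      using that 1 dist len by (auto simp: Masked_in_ccw_labels_iff' s_def Let_def)
    show ?thesis
    proof (cases s)
      case 0
      then have "i = u mod n"
        using mod_index_iff[of "u mod n" n 0 i] 1 s_def mod_less_n[of u] by fastforce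
      then show ?thesis using 1 own_in_K by simp
    next
      case (Suc s')
      then have "(i + n - (u + 1) mod n) mod n = s'"
        using cw_distance_Suc[of i n u s'] 1 s_def by simp
      then have "l \<in> ccw_labels (rotate (u + 1) M) s'"
        using 1 dist len s Suc
        by (auto simp: Masked_in_ccw_labels_iff' Let_def transmit_round_def simp del: rotate_Suc)
      moreover have "s' < t"
        using s Suc ccw_dist_less[of n k] len by (auto simp: transmit_round_def split: if_splits)
      ultimately show ?thesis by (rule from_right)
    qed
  qed
  ultimately show ?case by blast
qed

lemma dom_from_left: "l \<in> cw_labels (rotate (u + n - 1) M) s \<Longrightarrow> s < t \<Longrightarrow> l \<in> dom (K t u)"
  using labels_known[of "u + n - 1" s] K_dom_mono[of "Suc s" t u]
  unfolding K_Suc dom_map_add dom_restrict Suc_le_eq by blast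

lemma dom_from_right: "l \<in> ccw_labels (rotate (u + 1) M) s \<Longrightarrow> s < t \<Longrightarrow> l \<in> dom (K t u)"
  using labels_known[of "u + 1" s] K_dom_mono[of "Suc s" t u]
  unfolding K_Suc dom_map_add dom_restrict Suc_le_eq by blast

lemma well_formed_H: "well_formed (rotate u M) (H t u)"
proof -
  have 1: "rotate (length (rotate u M) - 1) (rotate u M) = rotate (u + n - 1) M"
    using len by (intro rotate_length_minus_1_rotate) linarith
  have 2: "rotate 1 (rotate u M) = rotate (u + 1) M" by simp
  have nth: "H t u ! s = (K s (u + n - 1) |` cw_labels (rotate (u + n - 1) M) s,
     K s (u + 1) |` ccw_labels (rotate (u + 1) M) s)" if "s < t" for s
    using that
  proof (induction t)
    case (Suc t)
    moreover have "length (H t u) = t" by (simp add: H_def)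
    ultimately show ?case by (cases "s = t") (auto simp: H_Suc nth_append)
  qed simp
  have "length (H t u) = t" by (simp add: H_def)
  then show ?thesis
    unfolding well_formed_def 1 2 using nth labels_known[THEN conjunct1] labels_known[THEN conjunct2]
    by (simp del: rotate_Suc add: Int_absorb1)
qed

text \<open>\<open>cw_dist\<close> and \<open>ccw_dist\<close> add up to \<open>n\<close>, so the
  shares going in opposite directions meet at the same agent, both passed on by its neighbours in
  round \<open>n - 1\<close>.\<close>

lemma K_shares:
  assumes "i < n" "(u + n - i) mod n = cw_dist n k" "n \<le> t"
  shows "K t u (Rand (M ! i) k) = Some (coin (c i) k)"
    and "K t u (Masked (M ! i) k) = Some (xor (coin (c i) k) (x i))"
proof -
  obtain s where s: "cw_dist n k = Suc s" using cw_dist_pos[OF len] gr0_conv_Suc by metis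
  have "(u + n - 1 + n - i) mod n = s" using ccw_distance_Suc[of i n u s] assms s by simp
  then have "Rand (M ! i) k \<in> cw_labels (rotate (u + n - 1) M) (n - 1)"
    using assms dist len s by (simp add: Rand_in_cw_labels_iff Let_def transmit_round_def)
  then have "Rand (M ! i) k \<in> dom (K t u)" by (rule dom_from_left) (use assms len in simp)
  then show "K t u (Rand (M ! i) k) = Some (coin (c i) k)" using K_values assms by auto
  obtain s' where s': "ccw_dist n k = Suc s'" using ccw_dist_pos[OF len] gr0_conv_Suc by metis
  have cd: "cw_dist n k + ccw_dist n k = n" 
    using ccw_dist_less[OF len, of k] by (simp add: cw_dist_def)
  \<comment> \<open>The hypothesis gives the clockwise distance from \<open>i\<close> to
    \<open>u\<close>; the masked share travels the complementary one.\<close>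
  have "(i + n - u mod n) mod n = ccw_dist n k"
  proof -
    define v where "v = u mod n"
    have v: "v < n" using mod_less_n v_def by simp
    have "(v + (n - i)) mod n = cw_dist n k"
      using assms mod_add_left_eq[of u n "n - i"] unfolding v_def by simp
    then have 1: "(v + n - i) mod n = cw_dist n k" using assms(1) by simp
    show ?thesis
    proof (cases "i \<le> v")
      case True
      then have "v + n - i = v - i + n" by simp
      then have "v - i = cw_dist n k" using 1 v by (metis mod_add_self2 mod_less less_imp_diff_less)
      then show ?thesis using cd v True s unfolding v_def[symmetric] by simp
    next
      case False
      then have "v + n - i = cw_dist n k" using 1 v by simp
      then have "i - v = ccw_dist n k" using cd False assms(1) by linarith
      moreover have "i + n - v = i - v + n" using False by simp
      moreover have "i - v < n" using assms by simp
      ultimately show ?thesis unfolding v_def[symmetric] by simp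
    qed
  qed
  then have "(i + n - (u + 1) mod n) mod n = s'" using cw_distance_Suc[of i n u s'] assms s' by simp
  then have "Masked (M ! i) k \<in> ccw_labels (rotate (u + 1) M) (n - 1)"
    using assms dist len s'
    by (simp add: Masked_in_ccw_labels_iff' Let_def transmit_round_def del: rotate_Suc)
  then have "Masked (M ! i) k \<in> dom (K t u)" by (rule dom_from_right) (use assms len in simp)
  then show "K t u (Masked (M ! i) k) = Some (xor (coin (c i) k) (x i))" using K_values assms by auto
qed

lemma K_Input:
  assumes "i < n"
  shows "K (2 * n) u (Input (M ! i)) = Some (x i)"
proof -
  have "Input (M ! i) \<in> dom (K (2 * n) u)"
  proof (cases "(u + n - i) mod n")
    case 0
    then have "i = u mod n" using mod_index_iff[of 0 n i u] assms by fastforce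
    then show ?thesis using own_in_K by simp
  next
    case (Suc s)
    then have s: "Suc s < n" by (metis mod_less_n)
    have "(u + n - 1 + n - i) mod n = s" using ccw_distance_Suc Suc assms by simp
    \<comment> \<open>Since \<open>s \<le> n - 2\<close>, this round is at most
      \<open>2 * n - 1\<close>, just before the output.\<close>
    then have "Input (M ! i) \<in> cw_labels (rotate (u + n - 1) M) (n + 1 + s)"
      using assms dist s by (simp add: Input_in_cw_labels_iff Let_def)
    then show ?thesis by (rule dom_from_left) (use s in simp)
  qed
  then show ?thesis using K_values assms by auto
qed

lemma consistent_K:
  assumes "\<And>i. i < n \<Longrightarrow> x i \<in> D"
  shows "consistent D (rotate u M) (K (2 * n) u)"
proof -
  have "the (K (2 * n) u (Input i)) \<in> D" if "i \<in> set M" for i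
    using that assms K_Input by (auto simp: in_set_conv_nth)
  moreover have "xor (the (K (2 * n) u (Rand i k))) (the (K (2 * n) u (Masked i k))) = the (K (2 * n) u (Input i))"
    if "i = ccw (rotate u M) (cw_dist n k)" for i k
  proof -
    have less: "cw_dist n k < n" using cw_dist_less[OF len] by simp
    \<comment> \<open>\<open>j\<close> is the agent whose recipient \<open>k\<close> is position
      \<open>u\<close>.\<close>
    define j where "j = (u + n - cw_dist n k) mod n"
    have i: "i = M ! j" using that less by (simp add: ccw_rotate j_def)
    have j: "j < n" unfolding j_def by (rule mod_less_n)
    have "(u + n - j) mod n = cw_dist n k" using mod_index_iff[OF less j, of u] j_def by simp
    then show ?thesis using K_shares[OF j, of u k "2 * n"] K_Input[OF j, of u]
      by (simp add: i flip: xor.assoc)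
  qed
  ultimately show ?thesis by (simp add: consistent_def Let_def)
qed

lemma decide_honest:
  assumes "\<And>i. i < n \<Longrightarrow> x i \<in> D" "u < n" "\<And>i. i < n \<Longrightarrow> g (M ! i) = x i"
  shows "decide (ring_profile D q M x c u) (received n (ring_profile D q M x c) (2 * n) u)
    = Some (q (map g (sort M)))"
proof -
  have u: "u mod n = u" using assms by simp
  have "map (\<lambda>i. the (K (2 * n) u (Input i))) (sort M) = map g (sort M)"
    using K_Input assms(3) by (auto simp: in_set_conv_nth)
  then show ?thesis
    using well_formed_H[of u "2 * n"] consistent_K[OF assms(1), of u]
    unfolding decide_ring_profile K_def H_def u by presburger
qed

end

section \<open>Executions with one cheater\<close>

lemma pred_mod:
  fixes u n :: nat
  assumes "1 \<le> u"
  shows "(u + n - 1) mod n = (u - 1) mod n"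
proof -
  have "u + n - 1 = u - 1 + n" using assms by simp
  then show ?thesis by (simp only: mod_add_self2)
qed

text \<open>
  The cheater is agent \<open>0\<close> of the real ring of \<open>n\<close> agents.  In the list \<open>M\<close> of the enlarged ring,
  position \<open>0\<close> is the last agent of the cheater's segment, positions \<open>1, \<dots>, n - 1\<close> are the honest
  agents, and positions \<open>n, \<dots>, length M - 1\<close> are the remaining agents of the segment.
\<close>

locale cheater_ring =
  fixes D :: "'l::len word set" and q :: "'l word list \<Rightarrow> 'y" and M :: "nat list" and n :: nat
    and x :: "nat \<Rightarrow> 'l word" and c :: "nat \<Rightarrow> 'l word \<times> 'l word"
    and B :: "('l word message, 'y) behaviour"
  assumes dist: "distinct M" and n3: "3 \<le> n" and nm: "n \<le> length M" and mn: "length M < 2 * n"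
begin

abbreviation m :: nat where "m \<equiv> length M"

definition Q :: "nat \<Rightarrow> ('l word message, 'y) behaviour" where
  "Q = (ring_profile D q M x c)(0 := B)"

definition H :: "nat \<Rightarrow> nat \<Rightarrow> 'l word message history" where
  "H t u = received n Q t u"

definition K :: "nat \<Rightarrow> nat \<Rightarrow> 'l word message" where
  "K t u = knowledge M x c u (H t u)"

definition well_informed :: "nat \<Rightarrow> bool" where
  "well_informed u \<longleftrightarrow> well_formed (rotate u M) (H (2 * m) u)"

text \<open>
  Agent \<open>1\<close> is the first recipient of position \<open>0\<close>, and agent \<open>i - m div 2\<close> is the second
  recipient of position \<open>i\<close>; both are honest.
\<close>

definition committed :: "nat \<Rightarrow> 'l word" where
  "committed i = (let (u, k) = if i = 0 then (1, B1) else (i - m div 2, B2)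
     in xor (the (K m u (Rand (M ! i) k))) (the (K m u (Masked (M ! i) k))))"

lemma rotate_pred: "1 \<le> u \<Longrightarrow> rotate (u + m - 1) M = rotate (u - 1) M"
  by (metis pred_mod rotate_conv_mod)

text \<open>From \<open>u = 2\<close> on the counter-clockwise neighbour is honest; that of position
  1 is the cheater.\<close>

lemma fst_H:
  assumes "2 \<le> u" "u < n" "s < t"
  shows "fst (H t u ! s) = K s (u - 1) |` cw_labels (rotate (u + m - 1) M) s"
proof -
  have "(u + n - 1) mod n = u - 1" using assms by (simp only: pred_mod) simp
  then show ?thesis
    using assms rotate_pred[of u] by (simp add: H_def K_def nth_received Q_def send_ring_profile)
qed

lemma dom_H:
  assumes "well_informed u" "s < 2 * m"
  shows "dom (fst (H (2 * m) u ! s)) = cw_labels (rotate (u + m - 1) M) s"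
    and "dom (snd (H (2 * m) u ! s)) = ccw_labels (rotate (u + 1) M) s"
proof -
  have 1: "rotate (length (rotate u M) - 1) (rotate u M) = rotate (u + m - 1) M"
    using nm n3 by (intro rotate_length_minus_1_rotate) linarith
  have 2: "rotate 1 (rotate u M) = rotate (u + 1) M" by simp
  have "length (H (2 * m) u) = 2 * m" by (simp add: H_def)
  then show "dom (fst (H (2 * m) u ! s)) = cw_labels (rotate (u + m - 1) M) s"
    "dom (snd (H (2 * m) u ! s)) = ccw_labels (rotate (u + 1) M) s"
    using assms unfolding well_informed_def well_formed_def 1 2 by auto
qed

lemma K_take: "t \<le> 2 * m \<Longrightarrow> K t u = known_values (rotate u M) (x u) (c u) (take t (H (2 * m) u))"
  by (simp add: K_def H_def knowledge_def take_received)

text \<open>A well-informed agent has received exactly the scheduled labels, so even the cheater can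
  alter its value of a label only in a round in which that label is due.\<close>

lemma K_unchanged:
  assumes "s \<le> 2 * m" "well_informed u"
    and "\<And>r. s \<le> r \<Longrightarrow> r < 2 * m \<Longrightarrow>
       l \<notin> cw_labels (rotate (u + m - 1) M) r \<and> l \<notin> ccw_labels (rotate (u + 1) M) r"
  shows "K (2 * m) u l = K s u l"
proof -
  have "length (H (2 * m) u) = 2 * m" by (simp add: H_def)
  then show ?thesis
    unfolding K_take[OF assms(1)] K_take[OF order_refl]
    using assms dom_H[OF assms(2)] by (intro known_values_unchanged) auto
qed

text \<open>An announcement stops just before its origin (the bound \<open>s + 1 < m\<close>), so no
  agent is ever due to receive its own input and the cheater cannot overwrite it.\<close>

lemma Input_own:
  assumes "u < n" "well_informed u"
  shows "K (2 * m) u (Input (M ! u)) = Some (x u)"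
proof -
  have u: "u < m" using assms nm by simp
  have "(u + m - 1 + m - u) mod m = m - 1"
  proof -
    have "u + m - 1 + m - u = m + m - 1" using u by simp
    then show ?thesis using u pred_mod[of m m] by simp
  qed
  then have "K (2 * m) u (Input (M ! u)) = K 0 u (Input (M ! u))"
    using assms u dist by (intro K_unchanged) (auto simp: Input_in_cw_labels_iff Let_def)
  also have "\<dots> = Some (x u)"
    using u dist by (simp add: K_def H_def knowledge_def own_values_rotate)
  finally show ?thesis .
qed

text \<open>The label is due exactly once at \<open>u\<close>, in round \<open>t\<close>, and comes
  from the honest agent \<open>u - 1\<close>, whose own value is final by then.\<close>

lemma Input_step:
  assumes u: "2 \<le> u" "u < n" and i: "i < m" "i \<noteq> u"
    and wf: "well_informed u" "well_informed (u - 1)"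
  shows "K (2 * m) u (Input (M ! i)) = K (2 * m) (u - 1) (Input (M ! i))"
proof -
  let ?l = "Input (M ! i)"
  define s where "s = (u + m - 1 + m - i) mod m"
  define t where "t = m + 1 + s"
  have um: "u < m" using u nm by simp
  have sm: "s < m" using i unfolding s_def by (intro mod_less_divisor) linarith
  \<comment> \<open>Distance \<open>m - 1\<close> from the origin to \<open>u - 1\<close> would make
    \<open>u\<close> itself the origin.\<close>
  have "s \<noteq> m - 1"
  proof
    assume "s = m - 1"
    then have "s + 1 = m" using i by simp
    then have "(s + 1) mod m = 0" by simp
    moreover have "(s + 1) mod m = (u + m - 1 + m - i + 1) mod m"
      unfolding s_def by (rule mod_add_left_eq)
    moreover have "u + m - 1 + m - i + 1 = (u + m - i) + m" using u i by simp
    ultimately have "(u + m - i) mod m = 0" by (metis mod_add_self2)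
    then have "i = (u + m - 0) mod m" using mod_index_iff[of 0 m i u] i by fastforce
    then show False using um i by simp
  qed
  then have s: "s + 1 < m" using sm by simp
  then have t: "t < 2 * m" by (simp add: t_def)
  have at: "?l \<in> cw_labels (rotate (u + m - 1) M) r \<longleftrightarrow> r = t" for r
    unfolding Input_in_cw_labels_iff[OF dist i(1) refl] Let_def s_def[symmetric] t_def using s by auto
  have len: "length (H (2 * m) u) = 2 * m" by (simp add: H_def)
  have "K (2 * m) u ?l = K (Suc t) u ?l"
    using t wf at by (intro K_unchanged) auto
  also have "\<dots> = (K t u ++ fst (H (2 * m) u ! t) ++ snd (H (2 * m) u ! t)) ?l"
    using t len by (simp add: K_take known_values_take_Suc)
  also have "\<dots> = fst (H (2 * m) u ! t) ?l"
  proof -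
    have "?l \<in> dom (fst (H (2 * m) u ! t))" using dom_H(1)[OF wf(1) t] at by simp
    moreover have "?l \<notin> dom (snd (H (2 * m) u ! t))" using dom_H(2)[OF wf(1) t] by simp
    ultimately show ?thesis by (simp only: map_add_dom_app_simps not_False_eq_True)
  qed
  also have "\<dots> = K t (u - 1) ?l"
    using fst_H[OF u t] at by simp
  \<comment> \<open>At \<open>u - 1\<close> the label was due in round \<open>t - 1\<close>, or
    never if \<open>u - 1\<close> is the origin (\<open>s = 0\<close>), so nothing changes from
    round \<open>t\<close> on.\<close>
  also have "\<dots> = K (2 * m) (u - 1) ?l"
  proof (rule sym, rule K_unchanged)
    fix r assume r: "t \<le> r" "r < 2 * m"
    define s' where "s' = (u - 1 + m - 1 + m - i) mod m"
    have "(s + (m - 1)) mod m = (u + m - 1 + m - i + (m - 1)) mod m"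
      unfolding s_def by (rule mod_add_left_eq)
    also have "u + m - 1 + m - i + (m - 1) = (u - 1 + m - 1 + m - i) + m" using u i by simp
    finally have s': "s' = (s + (m - 1)) mod m" by (simp add: s'_def)
    have "\<not> (s' + 1 < m \<and> m + 1 + s' = r)"
    proof (cases s)
      case 0
      then have "s' + 1 = m" using s' i by simp
      then show ?thesis by simp
    next
      case (Suc k)
      then have "s + (m - 1) = k + m" using i by simp
      then have "s' = k" using s' sm Suc by simp
      then show ?thesis using r t_def Suc by simp
    qed
    then show "?l \<notin> cw_labels (rotate (u - 1 + m - 1) M) r \<and> ?l \<notin> ccw_labels (rotate (u - 1 + 1) M) r"
      unfolding Input_in_cw_labels_iff[OF dist i(1) refl] Let_def s'_def by simp
  qed (use t wf in auto)
  finally show ?thesis .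
qed

text \<open>The last condition keeps the origin \<open>i\<close> off the positions
  \<open>u + 1, ..., v\<close>.\<close>

lemma Input_propagates:
  assumes wf: "\<And>w. 1 \<le> w \<Longrightarrow> w < n \<Longrightarrow> well_informed w"
    and "u \<le> v" "1 \<le> u" "v < n" "i < m" "i \<le> u \<or> v < i"
  shows "K (2 * m) v (Input (M ! i)) = K (2 * m) u (Input (M ! i))"
  using assms(2,4,6)
proof (induction v rule: dec_induct)
  case (step v)
  have "K (2 * m) (Suc v) (Input (M ! i)) = K (2 * m) (Suc v - 1) (Input (M ! i))"
    using step assms(3,5) by (intro Input_step wf) auto
  then show ?case using step by auto
qed simp

text \<open>Shares are due only in rounds below \<open>m\<close>, so they are final before any input
  is announced.\<close>

lemma shares_fixed:
  assumes "well_informed u" "i < m"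
  shows "K (2 * m) u (Rand (M ! i) k) = K m u (Rand (M ! i) k)"
    and "K (2 * m) u (Masked (M ! i) k) = K m u (Masked (M ! i) k)"
proof -
  have m: "2 \<le> length (rotate v M)" for v using nm n3 by simp
  show "K (2 * m) u (Rand (M ! i) k) = K m u (Rand (M ! i) k)"
    using assms Rand_in_cw_labelsD[OF _ m] by (intro K_unchanged) fastforce+
  show "K (2 * m) u (Masked (M ! i) k) = K m u (Masked (M ! i) k)"
    using assms Masked_in_ccw_labelsD[OF _ m] by (intro K_unchanged) fastforce+
qed

text \<open>An honest recipient of position \<open>i\<close> compares the announced input with the
  shares it held in round \<open>m\<close>, and the same announcement travels on through honest
  agents to \<open>n - 1\<close>.\<close>

lemma Input_committed:
  assumes "\<And>w. 1 \<le> w \<Longrightarrow> w < n \<Longrightarrow> well_informed w"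
    and "\<And>w. 1 \<le> w \<Longrightarrow> w < n \<Longrightarrow> consistent D (rotate w M) (K (2 * m) w)"
    and i: "i < m" "i = 0 \<or> n \<le> i"
  shows "the (K (2 * m) (n - 1) (Input (M ! i))) = committed i"
proof -
  obtain u k where uk: "(u, k) = (if i = 0 then (1, B1) else (i - m div 2, B2))"
    by (metis surj_pair)
  \<comment> \<open>The bound \<open>m < 2 * n\<close> makes the recipient honest:
    \<open>m div 2 < n \<le> i\<close>, and \<open>i - m div 2\<close> is at most
    \<open>(m - 1) div 2\<close>, which is below \<open>n\<close>.\<close>
  have u: "1 \<le> u" "u < n" using uk i n3 mn by (auto split: if_splits)
  have cm: "cw_dist m k < m" using nm n3 by (intro cw_dist_less) simp
  have "(u + m - cw_dist m k) mod m = i"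
  proof (cases "i = 0")
    case True
    then have "u = 1" "cw_dist m k = 1" using uk nm n3 by (auto simp: cw_dist_def)
    then show ?thesis using True by simp
  next
    case False
    then have "u = i - m div 2" "cw_dist m k = m - m div 2" using uk by (auto simp: cw_dist_def)
    moreover have "m div 2 \<le> i" using False i nm mn by simp
    ultimately have "u + m - cw_dist m k = i" by simp
    then show ?thesis using i by simp
  qed
  then have "M ! i = ccw (rotate u M) (cw_dist m k)" using cm by (simp add: ccw_rotate)
  then have "xor (the (K (2 * m) u (Rand (M ! i) k))) (the (K (2 * m) u (Masked (M ! i) k)))
      = the (K (2 * m) u (Input (M ! i)))"
    using assms(2)[OF u] by (simp add: consistent_def Let_def)
  moreover have "K (2 * m) (n - 1) (Input (M ! i)) = K (2 * m) u (Input (M ! i))"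
    using u i assms(1) by (intro Input_propagates) auto
  ultimately show ?thesis
    using shares_fixed[OF assms(1)[OF u] i(1)] by (simp add: committed_def flip: uk)
qed

text \<open>Agent \<open>n - 1\<close> is the last honest one clockwise: all honest inputs reach it
  through honest agents only, and those of the segment pass the agents that check them. Its
  knowledge therefore serves as \<open>g\<close>.\<close>

lemma unanimous_output:
  assumes "\<And>u. 1 \<le> u \<Longrightarrow> u < n \<Longrightarrow> decide (Q u) (received n Q (2 * m) u) = Some p"
  obtains g where "p = q (map g (sort M))" "\<And>i. i < m \<Longrightarrow> g (M ! i) \<in> D"
    "\<And>i. 1 \<le> i \<Longrightarrow> i < n \<Longrightarrow> g (M ! i) = x i"
    "\<And>i. i < m \<Longrightarrow> i = 0 \<or> n \<le> i \<Longrightarrow> g (M ! i) = committed i"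
proof -
  have *: "well_informed u \<and> consistent D (rotate u M) (K (2 * m) u) \<and>
      p = q (map (\<lambda>i. the (K (2 * m) u (Input i))) (sort M))" if "1 \<le> u" "u < n" for u
    using assms[OF that] that
    by (simp add: Q_def decide_ring_profile well_informed_def K_def H_def split: if_splits)
  define g where "g i = the (K (2 * m) (n - 1) (Input i))" for i
  have u: "1 \<le> n - 1" "n - 1 < n" using n3 by auto
  show ?thesis
  proof (rule that)
    show "p = q (map g (sort M))" using *[OF u] unfolding g_def by blast
    show "g (M ! i) \<in> D" if "i < m" for i
      using *[OF u] that by (simp add: consistent_def g_def)
    show "g (M ! i) = x i" if "1 \<le> i" "i < n" for i
    proof -
      have "K (2 * m) (n - 1) (Input (M ! i)) = K (2 * m) i (Input (M ! i))"
        using that nm * by (intro Input_propagates) auto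
      then show ?thesis using Input_own[of i] * that by (simp add: g_def)
    qed
    show "g (M ! i) = committed i" if "i < m" "i = 0 \<or> n \<le> i" for i
      unfolding g_def using Input_committed that * by blast
  qed
qed

end

section \<open>What the cheater cannot distinguish\<close>

text \<open>
  The values of agent \<open>i\<close> that the cheater does not see before its last transmission round, if
  \<open>i\<close> is the agent just before the cheater's segment.  When the input of \<open>i\<close> changes from \<open>y\<close> to
  \<open>y'\<close>, \<open>reshare\<close> adjusts the coins so that the two visible shares stay the same.
\<close>

definition hidden :: "nat \<Rightarrow> label set" where
  "hidden i = {Input i, Rand i B1, Masked i B2}"

definition reshare :: "'l::len word \<Rightarrow> 'l word \<Rightarrow> 'l word \<times> 'l word \<Rightarrow> 'l word \<times> 'l word" where
  "reshare y y' c = (xor (fst c) (xor y y'), snd c)"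

text \<open>These labels are what agents \<open>n - 1\<close> and \<open>1\<close> send to the
  cheater. Inputs are announced only after round \<open>m\<close>, and the \<open>B1\<close>
  recipient of agent \<open>n - 1\<close> is adjacent to it, so that random share waits at its
  origin until round \<open>m - 1\<close>.\<close>

lemma hidden_from_cheater:
  assumes "distinct M" "3 \<le> n" "n \<le> length M" "length M < 2 * n" "t + 1 < length M"
  shows "cw_labels (rotate (n - 1) M) t \<inter> hidden (M ! (n - 1)) = {}"
    and "ccw_labels (rotate 1 M) t \<inter> hidden (M ! (n - 1)) = {}"
proof -
  let ?m = "length M"
  have i: "n - 1 < ?m" and m: "2 \<le> ?m" using assms by auto
  have "Input (M ! (n - 1)) \<notin> cw_labels (rotate (n - 1) M) t"
    using Input_in_cw_labelsD[of "M ! (n - 1)" "rotate (n - 1) M" t] assms by auto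
  moreover have "Rand (M ! (n - 1)) B1 \<notin> cw_labels (rotate (n - 1) M) t"
    unfolding Rand_in_cw_labels_iff[OF assms(1) i m refl]
    using assms by (simp add: transmit_round_def cw_dist_def)
  ultimately show "cw_labels (rotate (n - 1) M) t \<inter> hidden (M ! (n - 1)) = {}"
    by (auto simp: hidden_def)
  have "(n - 1 + ?m - 1) mod ?m = (n - 1 - 1) mod ?m" using assms by (intro pred_mod) simp
  then have "(n - 1 + ?m - 1) mod ?m = n - 2" using assms by (simp add: numeral_2_eq_2)
  moreover have "(1::nat) \<le> ?m" using m by simp
  \<comment> \<open>Agent 1 is at distance \<open>n - 2\<close> from the origin and
    \<open>m div 2 \<le> n - 1\<close>, so it either does not pass this share on at all or is the
    last agent before the recipient and waits until round \<open>m - 1\<close>.\<close>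
  ultimately have "Masked (M ! (n - 1)) B2 \<notin> ccw_labels (rotate 1 M) t"
    unfolding Masked_in_ccw_labels_iff[OF assms(1) i m refl \<open>1 \<le> ?m\<close>]
    using assms by (simp add: transmit_round_def Let_def) linarith
  then show "ccw_labels (rotate 1 M) t \<inter> hidden (M ! (n - 1)) = {}"
    by (auto simp: hidden_def simp del: rotate_Suc One_nat_def)
qed

lemma xor_cancel_middle: "xor (xor a (xor y y')) y' = xor (a :: 'l::len word) y"
  by (metis xor.assoc xor_self_eq xor.right_neutral)

text \<open>Both claims are proved by one induction over the rounds. The first stops at history
  length \<open>m - 1\<close>, as round \<open>m - 1\<close> may deliver hidden shares; the second
  still holds at \<open>m\<close>, because what the cheater sends in round \<open>m - 1\<close>
  depends only on the shorter history.\<close>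

lemma indistinguishable:
  fixes B :: "('l::len word message, 'y) behaviour"
  assumes M: "distinct M" "3 \<le> n" "n \<le> length M" "length M < 2 * n"
    and x': "x' = x(n - 1 := y)" and c': "c' = c(n - 1 := reshare (x (n - 1)) y (c (n - 1)))"
    and Q: "Q = (ring_profile D q M x c)(0 := B)" and Q': "Q' = (ring_profile D q M x' c')(0 := B)"
    and "t \<le> length M"
  shows "(t < length M \<longrightarrow> received n Q t 0 = received n Q' t 0) \<and>
    (\<forall>u. 1 \<le> u \<longrightarrow> u < n \<longrightarrow> (\<forall>l. l \<notin> hidden (M ! (n - 1)) \<longrightarrow>
       knowledge M x c u (received n Q t u) l = knowledge M x' c' u (received n Q' t u) l))"
  using \<open>t \<le> length M\<close>
proof (induction t)
  case 0
  have "own_values (rotate u M) (x u) (c u) l = own_values (rotate u M) (x' u) (c' u) l"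
    if "1 \<le> u" "u < n" "l \<notin> hidden (M ! (n - 1))" for u l
  proof (cases "u = n - 1")
    case True
    have "M \<noteq> []" using M by auto
    then have hd: "hd (rotate u M) = M ! (n - 1)" using True M by (simp add: hd_rotate_conv_nth)
    show ?thesis
    proof (cases l)
      case (Rand i k)
      then show ?thesis using that hd True
        by (cases k) (auto simp: own_values_def x' c' reshare_def hidden_def)
    next
      case (Masked i k)
      then show ?thesis using that hd True
        by (cases k) (auto simp: own_values_def x' c' reshare_def hidden_def xor_cancel_middle)
    next
      case (Input i)
      then show ?thesis using that hd True
        by (auto simp: own_values_def x' c' reshare_def hidden_def)
    qed
  qed (simp add: x' c')
  then show ?case by (simp add: knowledge_def)
next
  case (Suc t)
  let ?h = "hidden (M ! (n - 1))"
  let ?K = "\<lambda>u. knowledge M x c u (received n Q t u)"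
  let ?K' = "\<lambda>u. knowledge M x' c' u (received n Q' t u)"
  have IH0: "received n Q t 0 = received n Q' t 0" using Suc by simp
  have IH: "?K u l = ?K' u l" if "1 \<le> u" "u < n" "l \<notin> ?h" for u l
    using Suc that by simp
  have n0: "(0 + n - 1) mod n = n - 1" "(0 + 1) mod n = 1" using M by auto
  have "received n Q (Suc t) 0 = received n Q' (Suc t) 0" if "Suc t < length M"
  proof -
    have "?K (n - 1) |` cw_labels (rotate (n - 1) M) t = ?K' (n - 1) |` cw_labels (rotate (n - 1) M) t"
    proof -
      have "1 \<le> n - 1" "n - 1 < n" using M by auto
      then show ?thesis
        using hidden_from_cheater(1)[OF M, of t] IH[of "n - 1"] that
        by (intro ext) (auto simp: restrict_map_def simp del: One_nat_def)
    qed
    moreover have "?K 1 |` ccw_labels (rotate 1 M) t = ?K' 1 |` ccw_labels (rotate 1 M) t"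
      using hidden_from_cheater(2)[OF M, of t] IH[of 1] that M
      by (intro ext) (auto simp: restrict_map_def simp del: rotate_Suc One_nat_def)
    ultimately show ?thesis
      using M unfolding received.simps Let_def n0 IH0 
      by (simp add: Q Q' send_ring_profile del: rotate_Suc)
  qed
  moreover have "knowledge M x c u (received n Q (Suc t) u) l = knowledge M x' c' u (received n Q' (Suc t) u) l"
    if u: "1 \<le> u" "u < n" and l: "l \<notin> ?h" for u l
  proof -
    define f where "f = fst (send (Q (u - 1)) (received n Q t (u - 1)))"
    define f' where "f' = fst (send (Q' (u - 1)) (received n Q' t (u - 1)))"
    define r where "r = (u + 1) mod n"
    define s where "s = snd (send (Q r) (received n Q t r))"
    define s' where "s' = snd (send (Q' r) (received n Q' t r))"
    \<comment> \<open>At \<open>u = 1\<close> the message comes from the cheater, who reacts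
      identically to an identical history; elsewhere it is honest knowledge restricted to the same
      labels.\<close>
    have f: "f l = f' l"
    proof (cases "u = 1")
      case True
      then show ?thesis by (simp add: f_def f'_def Q Q' IH0[unfolded Q Q'])
    next
      case False
      then show ?thesis using IH[of "u - 1" l] u l
        by (simp add: f_def f'_def Q Q' send_ring_profile restrict_map_def)
    qed
    have s: "s l = s' l"
    proof (cases "r = 0")
      case True
      then show ?thesis by (simp add: s_def s'_def Q Q' IH0[unfolded Q Q'])
    next
      case False
      have "r < n" using M by (simp add: r_def)
      then show ?thesis using IH[of r l] False l
        by (simp add: s_def s'_def Q Q' send_ring_profile restrict_map_def)
    qed
    have "(u + n - 1) mod n = u - 1" using u by (simp only: pred_mod) simp
    then have *: "received n Q (Suc t) u = received n Q t u @ [(f, s)]"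
      "received n Q' (Suc t) u = received n Q' t u @ [(f', s')]"
      by (simp_all add: Let_def f_def f'_def s_def s'_def r_def)
    show ?thesis unfolding * using f s IH[OF u l] by (auto simp: knowledge_def map_add_def split: option.split)
  qed
  ultimately show ?case by blast
qed

section \<open>Counting the inputs for which a cheater succeeds\<close>

lemma map_fun_upd_distinct:
  assumes "distinct xs" "j < length xs" "xs ! j = a"
  shows "map (g(a := y)) xs = (map g xs)[j := y]"
  using assms by (intro nth_equalityI) (auto simp: nth_list_update nth_eq_iff_index_eq)

text \<open>Only the neighbour's input varies, with its coins following. All successful runs
  evaluate \<open>q\<close> on lists that differ in one entry, so full knowledge bounds their
  number.\<close>

lemma cheater_success_card:
  fixes B :: "('l::len word message, 'y) behaviour" and x :: "nat \<Rightarrow> 'l word"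
    and c :: "nat \<Rightarrow> 'l word \<times> 'l word" and p :: 'y
  assumes M: "distinct M" "3 \<le> n" "n \<le> length M" "length M < 2 * n"
    and fk: "full_knowledge D q"
  defines "Q \<equiv> \<lambda>y. (ring_profile D q M (x(n - 1 := y))
      (c(n - 1 := reshare (x (n - 1)) y (c (n - 1)))))(0 := B)"
  defines "S \<equiv> {y \<in> D. \<forall>u. 1 \<le> u \<longrightarrow> u < n \<longrightarrow>
      decide (Q y u) (received n (Q y) (2 * length M) u) = Some p}"
  assumes "S \<noteq> {}"
  shows "p \<in> q_range D q" and "card S * card (q_range D q) \<le> card D"
proof -
  let ?x = "\<lambda>y. x(n - 1 := y)" and ?c = "\<lambda>y. c(n - 1 := reshare (x (n - 1)) y (c (n - 1)))"
  let ?m = "length M"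
  interpret base: cheater_ring D q M n x c B by unfold_locales (fact M)+
  have run: "cheater_ring M n" by unfold_locales (fact M)+
  have Q: "cheater_ring.Q D q M (?x y) (?c y) B = Q y" for y
    by (simp add: cheater_ring.Q_def[OF run] Q_def)
  \<comment> \<open>Committed values are read off shares in round \<open>m\<close> whose origin is
    not \<open>n - 1\<close>, hence off labels that are not hidden.\<close>
  have commit: "cheater_ring.committed D q M n (?x y) (?c y) B i = base.committed i"
    if i: "i < ?m" "i = 0 \<or> n \<le> i" for i y
  proof -
    obtain u k where uk: "(u, k) = (if i = 0 then (1, B1) else (i - ?m div 2, B2))"
      by (metis surj_pair)
    have u: "1 \<le> u" "u < n" using uk i M by (auto split: if_splits)
    have "M ! i \<noteq> M ! (n - 1)" using i M by (auto simp: nth_eq_iff_index_eq)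
    then have "Rand (M ! i) k \<notin> hidden (M ! (n - 1))" "Masked (M ! i) k \<notin> hidden (M ! (n - 1))"
      by (auto simp: hidden_def)
    moreover have "knowledge M x c u (received n base.Q ?m u) l =
        knowledge M (?x y) (?c y) u (received n (Q y) ?m u) l" if "l \<notin> hidden (M ! (n - 1))" for l
      using indistinguishable[OF M refl refl base.Q_def meta_eq_to_obj_eq[OF Q_def, THEN fun_cong], of ?m y]
        u that by blast
    ultimately show ?thesis
      by (simp add: cheater_ring.committed_def[OF run] cheater_ring.K_def[OF run]
          cheater_ring.H_def[OF run] Q flip: uk del: One_nat_def)
  qed
  have success: "\<exists>g. p = q (map g (sort M)) \<and> (\<forall>i<?m. g (M ! i) \<in> D) \<and> 
      (\<forall>i. 1 \<le> i \<longrightarrow> i < n \<longrightarrow> g (M ! i) = ?x y i) \<and>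
      (\<forall>i<?m. i = 0 \<or> n \<le> i \<longrightarrow> g (M ! i) = base.committed i)" if y: "y \<in> S" for y
  proof (rule cheater_ring.unanimous_output[OF run, of D q "?x y" "?c y" B p])
    fix u assume "1 \<le> u" "u < n"
    then show "decide (cheater_ring.Q D q M (?x y) (?c y) B u)
        (received n (cheater_ring.Q D q M (?x y) (?c y) B) (2 * ?m) u) = Some p"
      using y unfolding Q S_def by blast
  next
    fix g assume "p = q (map g (sort M))" "\<And>i. i < ?m \<Longrightarrow> g (M ! i) \<in> D"
      "\<And>i. 1 \<le> i \<Longrightarrow> i < n \<Longrightarrow> g (M ! i) = ?x y i"
      "\<And>i. i < ?m \<Longrightarrow> i = 0 \<or> n \<le> i \<Longrightarrow>
        g (M ! i) = cheater_ring.committed D q M n (?x y) (?c y) B i"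
    then show ?thesis by (intro exI[of _ g]) (simp add: commit del: One_nat_def)
  qed
  \<comment> \<open>One successful run supplies the reference list \<open>xs\<close>; success with
    \<open>y\<close> then implies \<open>q (xs[j := y]) = p\<close>.\<close>
  obtain y0 where "y0 \<in> S" using \<open>S \<noteq> {}\<close> by blast
  then obtain g0 where g0: "p = q (map g0 (sort M))" "\<forall>i<?m. g0 (M ! i) \<in> D"
      "\<forall>i. 1 \<le> i \<longrightarrow> i < n \<longrightarrow> g0 (M ! i) = ?x y0 i"
      "\<forall>i<?m. i = 0 \<or> n \<le> i \<longrightarrow> g0 (M ! i) = base.committed i"
    using success by blast
  define xs where "xs = map g0 (sort M)"
  have xsD: "set xs \<subseteq> D" using g0(2) by (auto simp: xs_def in_set_conv_nth)
  have "M \<noteq> []" using M by auto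
  then have "xs \<noteq> []" unfolding xs_def by (metis length_0_conv length_map length_sort)
  then show p: "p \<in> q_range D q" using g0(1) xsD unfolding q_range_def xs_def[symmetric] by blast
  have "M ! (n - 1) \<in> set (sort M)" using M by simp
  then obtain j where j: "j < length (sort M)" "sort M ! j = M ! (n - 1)"
    by (metis in_set_conv_nth)
  have "S \<subseteq> {y \<in> D. q (xs[j := y]) = p}"
  proof
    fix y assume y: "y \<in> S"
    then obtain g where g: "p = q (map g (sort M))"
      "\<forall>i. 1 \<le> i \<longrightarrow> i < n \<longrightarrow> g (M ! i) = ?x y i"
      "\<forall>i<?m. i = 0 \<or> n \<le> i \<longrightarrow> g (M ! i) = base.committed i"
      using success by blast
    have "g (M ! i) = (g0(M ! (n - 1) := y)) (M ! i)" if i: "i < ?m" for i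
    proof (cases "i = 0 \<or> n \<le> i")
      case True
      then have "M ! i \<noteq> M ! (n - 1)" using i M by (auto simp: nth_eq_iff_index_eq)
      moreover have "g (M ! i) = base.committed i" "g0 (M ! i) = base.committed i"
        using True g(3) g0(4) i by blast+
      ultimately show ?thesis by simp
    next
      case False
      moreover have "M ! i = M ! (n - 1) \<longleftrightarrow> i = n - 1" using i M by (simp add: nth_eq_iff_index_eq)
      ultimately show ?thesis using g(2) g0(3) by simp
    qed
    then have "map g (sort M) = map (g0(M ! (n - 1) := y)) (sort M)"
      by (intro map_cong refl) (metis in_set_conv_nth set_sort)
    also have "\<dots> = xs[j := y]"
      unfolding xs_def using M j by (intro map_fun_upd_distinct) simp_all
    finally show "y \<in> {y \<in> D. q (xs[j := y]) = p}" using g(1) y S_def by simp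
  qed
  then have "card S \<le> card {y \<in> D. q (xs[j := y]) = p}" by (intro card_mono) simp_all
  moreover have "card {y \<in> D. q (xs[j := y]) = p} * card (q_range D q) = card D"
    using full_knowledge_card[OF fk _ xsD _ p] j by (simp add: xs_def)
  ultimately show "card S * card (q_range D q) \<le> card D" by (metis mult_le_mono1)
qed

section \<open>Outcomes and distributions of worlds\<close>

lemma utility_outputs:
  assumes "a < n"
  shows "utility a p (outputs n P T) =
    of_bool (\<forall>j<n. decide (P j) (received n P T j) = Some p)"
proof -
  have "outputs n P T ! a = decide (P a) (received n P T a)" using assms by (simp add: outputs_def)
  moreover have "legal (outputs n P T) \<longleftrightarrow> (\<exists>y. \<forall>j<n. decide (P j) (received n P T j) = Some y)"
    by (auto simp: legal_def outputs_def)
  ultimately show ?thesis using assms by (auto simp: utility_def)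
qed

lemma received_reindex:
  assumes "\<And>u. u < n \<Longrightarrow> P ((a + u) mod n) = Q u" "u < n"
  shows "received n P t ((a + u) mod n) = received n Q t u"
proof -
  have "received n P t ((a + u) mod n) = received n (\<lambda>u. P ((a + u) mod n)) t u"
    using assms(2) received_rotate[of n P t a u] by simp
  also have "\<dots> = received n Q t u" using assms by (intro received_cong) auto
  finally show ?thesis .
qed

lemma sort_map_nth:
  "sort xs = map ((!) xs) (sort_key ((!) xs) [0..<length xs])"
proof (rule properties_for_sort)
  have "mset (map ((!) xs) (sort_key ((!) xs) [0..<length xs])) = mset (map ((!) xs) [0..<length xs])"
    by simp
  then show "mset (map ((!) xs) (sort_key ((!) xs) [0..<length xs])) = mset xs"
    by (simp only: map_nth)
qed simp

lemma cond_pmf_of_set: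
  assumes "finite A" "A \<inter> B \<noteq> {}"
  shows "cond_pmf (pmf_of_set A) B = pmf_of_set (A \<inter> B)"
proof (rule pmf_eqI)
  fix w
  have A: "A \<noteq> {}" using assms by auto
  then have "set_pmf (pmf_of_set A) \<inter> B \<noteq> {}" using assms by simp
  moreover have "real (card A) > 0" using A assms by (simp add: card_gt_0_iff)
  ultimately show "pmf (cond_pmf (pmf_of_set A) B) w = pmf (pmf_of_set (A \<inter> B)) w"
    using assms A by (simp add: pmf_cond measure_pmf_of_set indicator_def)
qed

text \<open>A randomised deviation is a mixture of deterministic ones, so a bound for each single
  \<open>B\<close> suffices.\<close>

lemma expected_utility_pair_le:
  assumes "finite W" "W \<noteq> {}"
    and le: "\<And>B. (\<Sum>\<omega>\<in>W. utility a p (f \<omega> B)) \<le> (\<Sum>\<omega>\<in>W. utility a p (h \<omega>))"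
  shows "expected_utility a p (map_pmf (\<lambda>(\<omega>, B). f \<omega> B) (pair_pmf (pmf_of_set W) S))
    \<le> expected_utility a p (map_pmf h (pmf_of_set W))"
proof -
  define U where "U = (\<lambda>(B, \<omega>). utility a p (f \<omega> B))"
  define v where "v = (\<Sum>\<omega>\<in>W. utility a p (h \<omega>)) / card W"
  have u: "0 \<le> utility a p Os" "utility a p Os \<le> 1" for Os by (auto simp: utility_def)
  have U: "0 \<le> U z" "U z \<le> 1" for z using u by (auto simp: U_def split: prod.split)
  have v: "0 \<le> v" unfolding v_def by (intro divide_nonneg_nonneg sum_nonneg u) simp
  have int: "integrable (measure_pmf X) U" for X
    by (rule measure_pmf.integrable_const_bound[where B = 1]) (use U in auto)
  \<comment> \<open>\<open>S\<close> may have infinite support; nonnegative integrals can be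
    iterated without integrability conditions.\<close>
  have "ennreal (measure_pmf.expectation (pair_pmf S (pmf_of_set W)) U)
      = (\<integral>\<^sup>+z. ennreal (U z) \<partial>pair_pmf S (pmf_of_set W))"
    by (rule nn_integral_eq_integral[symmetric]) (use int U in auto)
  also have "\<dots> = (\<integral>\<^sup>+B. \<integral>\<^sup>+\<omega>. ennreal (U (B, \<omega>)) \<partial>pmf_of_set W \<partial>S)"
    by (rule nn_integral_pair_pmf')
  also have "\<dots> \<le> (\<integral>\<^sup>+B. ennreal v \<partial>S)"
  proof (rule nn_integral_mono)
    fix B
    have "(\<integral>\<^sup>+\<omega>. ennreal (U (B, \<omega>)) \<partial>pmf_of_set W) = ennreal ((\<Sum>\<omega>\<in>W. U (B, \<omega>)) / card W)"
    proof -
      have "(\<integral>\<^sup>+\<omega>. ennreal (U (B, \<omega>)) \<partial>pmf_of_set W)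
          = ennreal (measure_pmf.expectation (pmf_of_set W) (\<lambda>\<omega>. U (B, \<omega>)))"
        by (rule nn_integral_eq_integral)
          (use U in \<open>auto intro!: measure_pmf.integrable_const_bound[where B = 1]\<close>)
      then show ?thesis using assms by (simp add: integral_pmf_of_set)
    qed
    also have "\<dots> \<le> ennreal v"
      unfolding v_def U_def using le[of B] by (intro ennreal_leI divide_right_mono) simp_all
    finally show "(\<integral>\<^sup>+\<omega>. ennreal (U (B, \<omega>)) \<partial>pmf_of_set W) \<le> ennreal v" .
  qed
  also have "\<dots> = ennreal v" by (simp add: measure_pmf.emeasure_space_1[simplified])
  finally have "measure_pmf.expectation (pair_pmf S (pmf_of_set W)) U \<le> v"
    using v by simp
  moreover have "expected_utility a p (map_pmf (\<lambda>(\<omega>, B). f \<omega> B) (pair_pmf (pmf_of_set W) S))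
      = measure_pmf.expectation (pair_pmf S (pmf_of_set W)) U"
    by (subst pair_commute_pmf)
      (simp add: expected_utility_def U_def case_prod_beta map_pmf_comp)
  moreover have "expected_utility a p (map_pmf h (pmf_of_set W)) = v"
    using assms by (simp add: expected_utility_def v_def integral_pmf_of_set)
  ultimately show ?thesis by simp
qed

text \<open>Outside \<open>{..<n}\<close> the value is \<open>undefined\<close>, the default of
  \<open>Pi_pmf\<close> in \<open>prior\<close>, so that for nonempty \<open>D\<close> the
  protocol's prior is uniform on exactly this set.\<close>

definition worlds :: "'x set \<Rightarrow> nat \<Rightarrow> ('x, 'c) world set" where
  "worlds D n = PiE_dflt {..<n} undefined (\<lambda>_. D) \<times> PiE_dflt {..<n} undefined (\<lambda>_. UNIV)"

lemma prior_eq: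
  fixes D :: "'l::len word set"
  assumes "D \<noteq> {}"
  shows "prior (knowledge_sharing_in_ring D q) n D = pmf_of_set (worlds D n)"
    and "finite (worlds D n :: ('l word, 'l word \<times> 'l word) world set)"
    and "(worlds D n :: ('l word, 'l word \<times> 'l word) world set) \<noteq> {}"
proof -
  let ?X = "PiE_dflt {..<n} undefined (\<lambda>_. D)"
  let ?C = "PiE_dflt {..<n} undefined (\<lambda>_. UNIV :: ('l word \<times> 'l word) set)"
  have fin: "finite ?X" "finite ?C" by (intro finite_PiE_dflt; simp)+
  have ne: "?X \<noteq> {}" "?C \<noteq> {}"
  proof -
    obtain d where "d \<in> D" using assms by blast
    then have "(\<lambda>i. if i < n then d else undefined) \<in> ?X" by (auto simp: PiE_dflt_def)
    then show "?X \<noteq> {}" by blast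
    have "(\<lambda>i. undefined) \<in> ?C" by (auto simp: PiE_dflt_def)
    then show "?C \<noteq> {}" by blast
  qed
  show "finite (worlds D n :: ('l word, 'l word \<times> 'l word) world set)"
    "(worlds D n :: ('l word, 'l word \<times> 'l word) world set) \<noteq> {}"
    using fin ne by (auto simp: worlds_def)
  have "Pi_pmf {..<n} undefined (\<lambda>_. pmf_of_set D) = pmf_of_set ?X"
    by (rule Pi_pmf_of_set) (use assms in auto)
  moreover have "Pi_pmf {..<n} undefined (\<lambda>_. pmf_of_set UNIV) = pmf_of_set ?C"
    by (rule Pi_pmf_of_set) auto
  moreover have "pair_pmf (pmf_of_set ?X) (pmf_of_set ?C) = pmf_of_set (?X \<times> ?C)"
  proof (rule pmf_eqI)
    fix z
    show "pmf (pair_pmf (pmf_of_set ?X) (pmf_of_set ?C)) z = pmf (pmf_of_set (?X \<times> ?C)) z"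
      using fin ne by (cases z) (simp add: pmf_pair indicator_def card_cartesian_product)
  qed
  ultimately show "prior (knowledge_sharing_in_ring D q) n D = pmf_of_set (worlds D n)"
    by (simp add: prior_def knowledge_sharing_in_ring_def worlds_def)
qed

lemma honest_profile_eq:
  "honest_profile (knowledge_sharing_in_ring D q) ids \<omega> = ring_profile D q ids (fst \<omega>) (snd \<omega>)"
  by (simp add: fun_eq_iff honest_profile_def knowledge_sharing_in_ring_def ring_profile_def)

lemma honest_outputs:
  assumes "distinct ids" "2 \<le> length ids" "\<omega> \<in> worlds D (length ids)"
  shows "outputs (length ids) (honest_profile (knowledge_sharing_in_ring D q) ids \<omega>) (2 * length ids)
    = replicate (length ids) (Some (q (map (fst \<omega>) (sort_key (\<lambda>j. ids ! j) [0..<length ids]))))"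
proof -
  let ?n = "length ids"
  interpret honest_ring D q ids "fst \<omega>" "snd \<omega>" by unfold_locales (fact assms)+
  \<comment> \<open>Agents look inputs up by id, the specification by index; \<open>g\<close>
    translates.\<close>
  define g where "g = (\<lambda>v. fst \<omega> (the_inv_into {..<?n} ((!) ids) v))"
  have g: "g (ids ! i) = fst \<omega> i" if "i < ?n" for i
    using that assms(1) by (simp add: g_def the_inv_into_f_f inj_on_nth)
  have "fst \<omega> i \<in> D" if "i < ?n" for i using assms(3) that by (auto simp: worlds_def PiE_dflt_def)
  then have "decide (ring_profile D q ids (fst \<omega>) (snd \<omega>) u)
      (received ?n (ring_profile D q ids (fst \<omega>) (snd \<omega>)) (2 * ?n) u) = Some (q (map g (sort ids)))"
    if "u < ?n" for u
    using decide_honest[of u g] g that by blast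
  then have "outputs ?n (ring_profile D q ids (fst \<omega>) (snd \<omega>)) (2 * ?n)
      = replicate ?n (Some (q (map g (sort ids))))"
    unfolding outputs_def by (intro nth_equalityI) simp_all
  moreover have "map g (sort ids) = map (fst \<omega>) (sort_key (\<lambda>j. ids ! j) [0..<?n])"
    by (subst sort_map_nth) (simp add: g)
  ultimately show ?thesis by (simp add: honest_profile_eq)
qed

section \<open>The equilibrium\<close>

text \<open>The averaging map: a new input for agent \<open>i\<close>, with its coins adjusted so
  that the visible shares stay.\<close>

definition resample :: "nat \<Rightarrow> 'l::len word \<Rightarrow> ('l word, 'l word \<times> 'l word) world
    \<Rightarrow> ('l word, 'l word \<times> 'l word) world" where
  "resample i y \<omega> = ((fst \<omega>)(i := y), (snd \<omega>)(i := reshare (fst \<omega> i) y (snd \<omega> i)))"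

lemma reshare_reshare: "reshare y x (reshare x y c) = c"
proof -
  have "xor (xor a (xor x y)) (xor x y) = a" for a
    by (metis xor.assoc xor_self_eq xor.right_neutral)
  then show ?thesis by (cases c) (simp add: reshare_def xor.commute[of y x])
qed

lemma resample_resample: "resample i (fst \<omega> i) (resample i y \<omega>) = \<omega>"
  by (simp add: resample_def reshare_reshare)

text \<open>Rotating by \<open>a + length F - 1\<close> puts the last agent of the segment at
  position 0, so the real agent \<open>u\<close> steps clockwise from \<open>a\<close> sits at
  position \<open>u\<close>.\<close>

lemma honest_position:
  assumes "a < length ids" "F \<noteq> []" "1 \<le> u" "u < length ids"
  shows "rotate (enlarged_position a (length F) ((a + u) mod length ids)) (enlarged_ring ids a F)
    = rotate u (rotate (a + length F - 1) (enlarged_ring ids a F))"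
proof -
  let ?n = "length ids" and ?E = "enlarged_ring ids a F" and ?d = "length F"
  have E: "length ?E = ?n + ?d - 1" using assms by (simp add: enlarged_ring_def)
  have d: "0 < ?d" using assms by simp
  have "rotate u (rotate (a + ?d - 1) ?E) = rotate (u + (a + ?d - 1)) ?E" by (simp add: rotate_rotate)
  moreover have "rotate (enlarged_position a ?d ((a + u) mod ?n)) ?E = rotate (u + (a + ?d - 1)) ?E"
  proof (cases "a + u < ?n")
    case True
    then have "enlarged_position a ?d ((a + u) mod ?n) = u + (a + ?d - 1)"
      using assms by (cases F) (simp_all add: enlarged_position_def)
    then show ?thesis by simp
  next
    case False
    then have "(a + u) mod ?n = a + u - ?n" using assms by (simp add: add_mod_cases)
    then have p: "enlarged_position a ?d ((a + u) mod ?n) = a + u - ?n"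
      using assms by (simp add: enlarged_position_def)
    \<comment> \<open>After wrapping around, the index has lost \<open>?n\<close> and the segment's
      \<open>?d - 1\<close>, together one full turn of \<open>?E\<close>.\<close>
    have "u + (a + ?d - 1) = a + u - ?n + length ?E" 
      unfolding E using False assms(2) by (cases F) simp_all
    then have "(u + (a + ?d - 1)) mod length ?E = (a + u - ?n) mod length ?E"
      by (simp only: mod_add_self2)
    then show ?thesis unfolding p by (metis rotate_conv_mod)
  qed
  ultimately show ?thesis by simp
qed

text \<open>An honest Wake-Up is a duplication into a single agent, so early deviations reduce to
  duplications.\<close>

lemma duplication_profile_honest:
  "honest_profile A ids \<omega> j = duplication_profile A ids a [ids ! a] B \<omega> j" if "j \<noteq> a" "a < length ids"
  using that by (simp add: honest_profile_def duplication_profile_def enlarged_position_def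
      enlarged_ring_def id_take_nth_drop[symmetric])

text \<open>\<open>Bf\<close> may use the cheater's own input and coins, so this covers both
  duplication (\<open>r = 0\<close>, constant \<open>Bf\<close>) and deviations from a round
  \<open>r < n\<close> after an honest Wake-Up (\<open>length F = 1\<close>). The averaging is over
  the input of the counter-clockwise real neighbour \<open>o'\<close>.\<close>

lemma utility_duplication_le:
  fixes D :: "'l::len word set" and q :: "'l word list \<Rightarrow> 'y"
  defines "A \<equiv> knowledge_sharing_in_ring D q"
  assumes ids: "distinct ids" "3 \<le> length ids" and fk: "full_knowledge D q" and "D \<noteq> {}"
    and a: "a < length ids"
    and F: "F \<noteq> []" "length F \<le> length ids" "distinct (enlarged_ring ids a F)"
    and r: "r < length ids"
    and Bf: "\<And>\<omega> \<omega>'. fst \<omega> a = fst \<omega>' a \<Longrightarrow> snd \<omega> a = snd \<omega>' a \<Longrightarrow> Bf \<omega> = Bf \<omega>'"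
    and W: "W = worlds D (length ids) \<inter> {\<omega>. view A ids a r \<omega> = v}"
  shows "(\<Sum>\<omega>\<in>W. utility a p (outputs (length ids) (duplication_profile A ids a F (Bf \<omega>) \<omega>)
            (2 * length (enlarged_ring ids a F))))
    \<le> (\<Sum>\<omega>\<in>W. utility a p (outputs (length ids) (honest_profile A ids \<omega>) (2 * length ids)))"
proof -
  let ?n = "length ids"
  let ?M = "rotate (a + length F - 1) (enlarged_ring ids a F)"
  define o' where "o' = (a + (?n - 1)) mod ?n"
  have o': "o' < ?n" "o' \<noteq> a"
  proof -
    have "0 < ?n" using ids by linarith
    then show "o' < ?n" by (simp add: o'_def)
    show "o' \<noteq> a" 
      unfolding o'_def using a ids add_mod_cases[of a ?n "?n - 1"] by (auto split: if_splits)
  qed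
  have index_o: "(a + u) mod ?n = o' \<longleftrightarrow> u = ?n - 1" if "u < ?n" for u
    unfolding o'_def using that a add_mod_cases[of a ?n "?n - 1"] add_mod_cases[of a ?n u] by auto
  have index_a: "(a + u) mod ?n = a \<longleftrightarrow> u = 0" if "u < ?n" for u
    using that a add_mod_cases[of a ?n u] by auto
  \<comment> \<open>The enlarged ring has \<open>?n + length F - 1\<close> agents, so
    \<open>length F \<le> ?n\<close> is exactly the bound \<open>length ?M < 2 * ?n\<close>.\<close>
  have M: "distinct ?M" "3 \<le> ?n" "?n \<le> length ?M" "length ?M < 2 * ?n"
    using F ids a by (auto simp: enlarged_ring_def Suc_le_eq simp flip: length_greater_0_conv)
  have lenM: "length (enlarged_ring ids a F) = length ?M" by simp
  have M0: "distinct (rotate a ids)" "3 \<le> ?n" "?n \<le> length (rotate a ids)" "length (rotate a ids) < 2 * ?n"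
    using ids by auto
  show ?thesis
  proof (rule sum_le_by_averaging[where D = D and T = "\<lambda>\<omega> y. resample o' y \<omega>" and p = "\<lambda>\<omega>. fst \<omega> o'"])
    have "finite (worlds D ?n :: ('l word, 'l word \<times> 'l word) world set)"
      using \<open>D \<noteq> {}\<close> by (rule prior_eq)
    then show "finite W" unfolding W by blast
    show "finite D" by simp
    show "D \<noteq> {}" by fact
    show "fst \<omega> o' \<in> D" if "\<omega> \<in> W" for \<omega>
      using that o' by (auto simp: W worlds_def PiE_dflt_def)
    show "resample o' (fst \<omega> o') (resample o' y \<omega>) = \<omega>" for \<omega> y by (rule resample_resample)
    show "fst (resample o' y \<omega>) o' = y" for \<omega> y by (simp add: resample_def)
    show "resample o' y \<omega> \<in> W" if "\<omega> \<in> W" "y \<in> D" for \<omega> y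
    proof -
      have "resample o' y \<omega> \<in> worlds D ?n"
        using that o' by (auto simp: W worlds_def PiE_dflt_def resample_def)
      \<comment> \<open>The view stems from an honest execution on the real ring, so
        \<open>indistinguishable\<close> is applied with the cheater's honest behaviour as
        \<open>B\<close>; its history stays the same as long as \<open>r < ?n\<close>.\<close>
      moreover have "view A ids a r (resample o' y \<omega>) = view A ids a r \<omega>"
      proof -
        let ?x = "\<lambda>u. fst \<omega> ((a + u) mod ?n)" and ?c = "\<lambda>u. snd \<omega> ((a + u) mod ?n)"
        let ?x' = "?x(?n - 1 := y)" and ?c' = "?c(?n - 1 := reshare (?x (?n - 1)) y (?c (?n - 1)))"
        define B where "B = ring_profile D q (rotate a ids) ?x ?c 0"
        define Q where "Q = (ring_profile D q (rotate a ids) ?x ?c)(0 := B)"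
        define Q' where "Q' = (ring_profile D q (rotate a ids) ?x' ?c')(0 := B)"
        have rot: "rotate ((a + u) mod ?n) ids = rotate u (rotate a ids)" for u
          by (metis add.commute rotate_conv_mod rotate_rotate)
        have 1: "honest_profile A ids \<omega> ((a + u) mod ?n) = Q u" if "u < ?n" for u
          unfolding A_def honest_profile_eq by (simp add: Q_def B_def ring_profile_def rot)
        have 2: "honest_profile A ids (resample o' y \<omega>) ((a + u) mod ?n) = Q' u" if "u < ?n" for u
        proof (cases "u = 0")
          case True
          then show ?thesis using index_o[OF that] index_a[OF that] ids a o'
            unfolding A_def honest_profile_eq
            by (simp add: Q'_def B_def ring_profile_def resample_def)
        next
          case False
          then show ?thesis using index_o[OF that]
            unfolding A_def honest_profile_eq
            by (auto simp: Q'_def ring_profile_def rot resample_def o'_def[symmetric])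
        qed
        have "0 < ?n" using ids by linarith
        then have "received ?n (honest_profile A ids \<omega>) r ((a + 0) mod ?n) = received ?n Q r 0"
          "received ?n (honest_profile A ids (resample o' y \<omega>)) r ((a + 0) mod ?n) = received ?n Q' r 0"
          using received_reindex[of ?n "honest_profile A ids \<omega>" a Q, OF 1]
            received_reindex[of ?n "honest_profile A ids (resample o' y \<omega>)" a Q', OF 2] by blast+
        moreover have "received ?n Q r 0 = received ?n Q' r 0"
          using indistinguishable[OF M0 refl refl Q_def Q'_def, of r] r by simp
        ultimately show ?thesis using a o' by (simp add: view_def resample_def)
      qed
      ultimately show ?thesis using that by (simp add: W)
    qed
  next
    fix \<omega> assume \<omega>: "\<omega> \<in> W"
    let ?x = "\<lambda>u. fst \<omega> ((a + u) mod ?n)" and ?c = "\<lambda>u. snd \<omega> ((a + u) mod ?n)"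
    define Q where "Q = (\<lambda>y. (ring_profile D q ?M (?x(?n - 1 := y))
       (?c(?n - 1 := reshare (?x (?n - 1)) y (?c (?n - 1)))))(0 := Bf \<omega>))"
    define S where "S = {y \<in> D. \<forall>u. 1 \<le> u \<longrightarrow> u < ?n \<longrightarrow>
      decide (Q y u) (received ?n (Q y) (2 * length ?M) u) = Some p}"
    let ?P = "\<lambda>y. duplication_profile A ids a F (Bf (resample o' y \<omega>)) (resample o' y \<omega>)"
    have Bf: "Bf (resample o' y \<omega>) = Bf \<omega>" for y
      using o' by (intro Bf) (auto simp: resample_def)
    have P: "?P y ((a + u) mod ?n) = Q y u" if "u < ?n" for u y
    proof (cases "u = 0")
      case True
      then show ?thesis using a by (simp add: duplication_profile_def Q_def Bf)
    next
      case False
      then have "rotate (enlarged_position a (length F) ((a + u) mod ?n)) (enlarged_ring ids a F) = rotate u ?M"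
        using a F that by (intro honest_position) auto
      moreover have "(a + u) mod ?n \<noteq> a" using False index_a[OF that] by simp
      ultimately show ?thesis using False index_o[OF that]
        by (auto simp: duplication_profile_def Q_def A_def knowledge_sharing_in_ring_def ring_profile_def
            resample_def o'_def[symmetric])
    qed
    \<comment> \<open>Only an inequality, since \<open>S\<close> ignores the cheater's own
      output.\<close>
    have "utility a p (outputs ?n (?P y) (2 * length ?M)) \<le> of_bool (y \<in> S)" if "y \<in> D" for y
    proof (cases "\<forall>j<?n. decide (?P y j) (received ?n (?P y) (2 * length ?M) j) = Some p")
      case True
      have "decide (Q y u) (received ?n (Q y) (2 * length ?M) u) = Some p" if "u < ?n" for u
      proof -
        have "(a + u) mod ?n < ?n" using that by (intro mod_less_divisor) linarith
        then have "decide (?P y ((a + u) mod ?n)) (received ?n (?P y) (2 * length ?M) ((a + u) mod ?n)) = Some p"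
          using True by blast
        then show ?thesis using received_reindex[of ?n "?P y" a "Q y", OF P[where y = y] that] P[OF that] by simp
      qed
      then have "y \<in> S" using that by (simp add: S_def)
      then show ?thesis by (simp add: utility_def)
    next
      case False
      then have "utility a p (outputs ?n (?P y) (2 * length ?M)) = 0"
        unfolding utility_outputs[OF a] by (simp only: of_bool_eq)
      then show ?thesis by simp
    qed
    then have "(\<Sum>y\<in>D. utility a p (outputs ?n (?P y) (2 * length ?M))) \<le> (\<Sum>y\<in>D. of_bool (y \<in> S))"
      by (intro sum_mono)
    also have "\<dots> = real (card S)"
      by (simp add: S_def Int_def)
    finally have U: "(\<Sum>y\<in>D. utility a p (outputs ?n (?P y) (2 * length (enlarged_ring ids a F)))) \<le> real (card S)"
      by (simp only: lenM)
    define js where "js = sort_key (\<lambda>j. ids ! j) [0..<?n]"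
    have "o' \<in> set js" using o' by (simp add: js_def)
    then obtain j where j: "j < length js" "js ! j = o'" by (metis in_set_conv_nth)
    define xs where "xs = map (fst \<omega>) js"
    have xsD: "set xs \<subseteq> D" using \<omega> by (auto simp: xs_def js_def W worlds_def PiE_dflt_def)
    have V: "utility a p (outputs ?n (honest_profile A ids (resample o' y \<omega>)) (2 * ?n))
        = of_bool (q (xs[j := y]) = p)" if "y \<in> D" for y
    proof -
      have "resample o' y \<omega> \<in> worlds D ?n"
        using \<omega> that o' by (auto simp: W worlds_def PiE_dflt_def resample_def)
      then have "outputs ?n (honest_profile A ids (resample o' y \<omega>)) (2 * ?n)
          = replicate ?n (Some (q (map (fst (resample o' y \<omega>)) js)))"
        unfolding A_def js_def using ids by (intro honest_outputs) auto
      moreover have "map (fst (resample o' y \<omega>)) js = xs[j := y]"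
        unfolding xs_def resample_def fst_conv
        using j by (intro map_fun_upd_distinct) (simp_all add: js_def)
      ultimately show ?thesis using a by (auto simp: utility_def legal_def)
    qed
    have "(\<Sum>y\<in>D. utility a p (outputs ?n (honest_profile A ids (resample o' y \<omega>)) (2 * ?n)))
        = (\<Sum>y\<in>D. of_bool (q (xs[j := y]) = p))"
      by (intro sum.cong refl V)
    also have "\<dots> = real (card {y \<in> D. q (xs[j := y]) = p})" by (simp add: Int_def)
    finally have V: "(\<Sum>y\<in>D. utility a p (outputs ?n (honest_profile A ids (resample o' y \<omega>)) (2 * ?n)))
        = real (card {y \<in> D. q (xs[j := y]) = p})" .
    \<comment> \<open>A value outside the range is never reached; one in the range is reached for at
      most \<open>card D / card (q_range D q)\<close> inputs, the number that honest runs attain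
      exactly.\<close>
    have "card S \<le> card {y \<in> D. q (xs[j := y]) = p}"
    proof (cases "S = {}")
      case False
      have p: "p \<in> q_range D q" and S: "card S * card (q_range D q) \<le> card D"
        using cheater_success_card[OF M fk] False unfolding S_def Q_def by blast+
      have eq: "card {y \<in> D. q (xs[j := y]) = p} * card (q_range D q) = card D"
        using full_knowledge_card[OF fk _ xsD _ p] j by (simp add: xs_def)
      moreover have "card D > 0" using \<open>D \<noteq> {}\<close> by (simp add: card_gt_0_iff)
      ultimately have "0 < card (q_range D q)" by (metis gr0I mult_0_right less_irrefl)
      then show ?thesis using S unfolding eq[symmetric] by simp
    qed simp
    then show "(\<Sum>y\<in>D. utility a p (outputs ?n (?P y) (2 * length (enlarged_ring ids a F))))
        \<le> (\<Sum>y\<in>D. utility a p (outputs ?n (honest_profile A ids (resample o' y \<omega>)) (2 * ?n)))"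
      unfolding V using U by linarith
  qed
qed

text \<open>The bound holds in each world separately: by round \<open>n\<close> agent 1 holds both
  genuine shares of the cheater's input, so a unanimous output is the honest one.\<close>

lemma utility_late_deviation_le:
  fixes D :: "'l::len word set" and q :: "'l word list \<Rightarrow> 'y"
  defines "A \<equiv> knowledge_sharing_in_ring D q"
  assumes ids: "distinct ids" "3 \<le> length ids" and a: "a < length ids" and r: "length ids \<le> r"
    and \<omega>: "\<omega> \<in> worlds D (length ids)"
  shows "utility a p (outputs (length ids) ((honest_profile A ids \<omega>)
       (a := deviate_from r (honest_profile A ids \<omega> a) B)) (2 * length ids))
    \<le> utility a p (outputs (length ids) (honest_profile A ids \<omega>) (2 * length ids))"
proof -
  let ?n = "length ids" and ?M = "rotate a ids"
  let ?x = "\<lambda>u. fst \<omega> ((a + u) mod ?n)" and ?c = "\<lambda>u. snd \<omega> ((a + u) mod ?n)"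
  let ?H = "ring_profile D q ?M ?x ?c"
  let ?B = "deviate_from r (?H 0) B"
  let ?P = "(honest_profile A ids \<omega>)(a := deviate_from r (honest_profile A ids \<omega> a) B)"
  have rot: "rotate ((a + u) mod ?n) ids = rotate u ?M" for u
    by (metis add.commute rotate_conv_mod rotate_rotate)
  have n: "0 < ?n" using ids by linarith
  have H: "honest_profile A ids \<omega> ((a + u) mod ?n) = ?H u" for u
    unfolding A_def honest_profile_eq by (simp add: ring_profile_def rot)
  have Ha: "honest_profile A ids \<omega> a = ?H 0" using H[of 0] a by simp
  have P: "?P ((a + u) mod ?n) = (?H(0 := ?B)) u" if "u < ?n" for u
  proof -
    have "(a + u) mod ?n = a \<longleftrightarrow> u = 0" using that a add_mod_cases[of a ?n u] by auto
    then show ?thesis using H[of u] Ha by auto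
  qed
  interpret honest: honest_ring D q ?M ?x ?c by unfold_locales (use ids in auto)
  interpret cheater_ring D q ?M ?n ?x ?c ?B by unfold_locales (use ids in auto)
  have "\<forall>j<?n. decide (honest_profile A ids \<omega> j) (received ?n (honest_profile A ids \<omega>) (2 * ?n) j) = Some p"
    if dev: "\<forall>j<?n. decide (?P j) (received ?n ?P (2 * ?n) j) = Some p"
  proof -
    have "decide (Q u) (received ?n Q (2 * m) u) = Some p" if "u < ?n" for u
    proof -
      have "(a + u) mod ?n < ?n" using n by simp
      then have "decide (?P ((a + u) mod ?n)) (received ?n ?P (2 * ?n) ((a + u) mod ?n)) = Some p"
        using dev by blast
      then show ?thesis using received_reindex[of ?n ?P a "?H(0 := ?B)", OF P that] P[OF that] by (simp add: Q_def)
    qed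
    then obtain g where g: "p = q (map g (sort ?M))"
      "\<And>i. 1 \<le> i \<Longrightarrow> i < ?n \<Longrightarrow> g (?M ! i) = ?x i"
      "\<And>i. i < m \<Longrightarrow> i = 0 \<or> ?n \<le> i \<Longrightarrow> g (?M ! i) = committed i"
      by (rule unanimous_output) blast+
    have "received ?n Q ?n 1 = received ?n ?H ?n 1"
      unfolding Q_def using r by (rule received_deviate_from)
    then have K: "K ?n 1 = honest.K ?n 1"
      using ids by (simp add: K_def H_def honest.K_def honest.H_def)
    have "cw_dist ?n B1 = 1" "(1 + ?n) mod ?n = 1 mod ?n" using ids by (simp add: cw_dist_def) (rule mod_add_self2)
    then have "(1 + ?n - 0) mod ?n = cw_dist ?n B1" using ids by simp
    then have "K ?n 1 (Rand (?M ! 0) B1) = Some (coin (?c 0) B1)"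
      "K ?n 1 (Masked (?M ! 0) B1) = Some (xor (coin (?c 0) B1) (?x 0))"
      unfolding K using n honest.K_shares[of 0 1 B1 ?n] by simp_all
    \<comment> \<open>Without duplication position 0 is the whole segment, so this is the only input
      to pin down.\<close>
    then have "committed 0 = ?x 0" by (simp add: committed_def flip: xor.assoc)
    then have g': "g (?M ! i) = ?x i" if "i < ?n" for i
      using g(2)[of i] g(3)[of 0] that n by (cases "i = 0") auto
    show ?thesis
    proof (intro allI impI)
      fix j assume j: "j < ?n"
      define u where "u = (j + ?n - a) mod ?n"
      have u: "u < ?n" using n by (simp add: u_def)
      have "(a + u) mod ?n = (a + (j + ?n - a)) mod ?n" unfolding u_def by (rule mod_add_right_eq)
      then have ju: "j = (a + u) mod ?n" using a j by simp
      have "?x i \<in> D" for i using \<omega> n by (auto simp: worlds_def PiE_dflt_def)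
      then have "decide (?H u) (received ?n ?H (2 * ?n) u) = Some p"
        using honest.decide_honest[of u g] u g' g(1) by simp
      then show "decide (honest_profile A ids \<omega> j) (received ?n (honest_profile A ids \<omega>) (2 * ?n) j) = Some p"
        using received_reindex[of ?n "honest_profile A ids \<omega>" a ?H, OF H u] unfolding ju H by simp
    qed
  qed
  then show ?thesis unfolding utility_outputs[OF a] by auto
qed

theorem theorem3p1:
  fixes ids :: "nat list"
    and D :: "'l::len word set"
    and q :: "'l word list \<Rightarrow> 'y"
    and pref :: "nat \<Rightarrow> 'y"
  assumes "distinct ids" and "length ids \<ge> 3"
    and "D \<noteq> {}"
    and "full_knowledge D q"
  shows "solves_knowledge_sharing (knowledge_sharing_in_ring D q) ids D q \<and>
         equilibrium_upto (length ids) (knowledge_sharing_in_ring D q) ids D pref"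
proof
  let ?A = "knowledge_sharing_in_ring D q" and ?n = "length ids"
  note prior = prior_eq[OF \<open>D \<noteq> {}\<close>]
  have dur: "duration ?A k = 2 * k" for k by (simp add: knowledge_sharing_in_ring_def)
  have support: "set_pmf (prior ?A ?n D) = worlds D ?n"
    unfolding prior(1) by (intro set_pmf_of_set prior)
  show "solves_knowledge_sharing ?A ids D q"
    unfolding solves_knowledge_sharing_def Let_def support dur
    using assms by (intro ballI honest_outputs) auto
  show "equilibrium_upto ?n ?A ids D pref"
    unfolding equilibrium_upto_def Let_def support
  proof (intro allI impI ballI conjI)
    fix a and \<omega>\<^sub>0 :: "('l word, 'l word \<times> 'l word) world"
    assume a: "a < ?n" and \<omega>\<^sub>0: "\<omega>\<^sub>0 \<in> worlds D ?n"
    define W where "W r = worlds D ?n \<inter> {\<omega>. view ?A ids a r \<omega> = view ?A ids a r \<omega>\<^sub>0}" for r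
    have W: "finite (W r)" "W r \<noteq> {}" for r using prior \<omega>\<^sub>0 by (auto simp: W_def)
    \<comment> \<open>Conditioning the uniform prior on a view gives the uniform distribution on the
      compatible worlds.\<close>
    have posterior: "posterior ?A ids D a r \<omega>\<^sub>0 = pmf_of_set (W r)" for r
      unfolding posterior_def prior W_def
      using prior W[of r] unfolding W_def by (intro cond_pmf_of_set)
    {
      fix r S assume "r \<le> duration ?A ?n"
      show "expected_utility a (pref a) (deviation_outcome ?A ids a r S (posterior ?A ids D a r \<omega>\<^sub>0))
        \<le> expected_utility a (pref a) (honest_outcome ?A ids (posterior ?A ids D a r \<omega>\<^sub>0))"
        unfolding deviation_outcome_def honest_outcome_def posterior Let_def dur
      proof (rule expected_utility_pair_le[OF W])
        fix B
        show "(\<Sum>\<omega>\<in>W r. utility a (pref a) (outputs ?n ((honest_profile ?A ids \<omega>)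
              (a := deviate_from r (honest_profile ?A ids \<omega> a) B)) (2 * ?n)))
          \<le> (\<Sum>\<omega>\<in>W r. utility a (pref a) (outputs ?n (honest_profile ?A ids \<omega>) (2 * ?n)))"
        \<comment> \<open>Before round \<open>?n\<close> the neighbour's input is still hidden and
          averaging applies; from then on the cheater's input is fixed and worlds are compared one
          by one.\<close>
        proof (cases "r < ?n")
          case True
          have E: "enlarged_ring ids a [ids ! a] = ids"
            using a by (simp add: enlarged_ring_def id_take_nth_drop[symmetric])
          let ?Bf = "\<lambda>\<omega>. deviate_from r (honest_profile ?A ids \<omega> a) B"
          have eq: "(honest_profile ?A ids \<omega>)(a := ?Bf \<omega>) = duplication_profile ?A ids a [ids ! a] (?Bf \<omega>) \<omega>" for \<omega>
            using duplication_profile_honest[OF _ a, of _ ?A \<omega> "?Bf \<omega>"]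
            by (auto simp: fun_eq_iff duplication_profile_def)
          have "(\<Sum>\<omega>\<in>W r. utility a (pref a) (outputs ?n
                (duplication_profile ?A ids a [ids ! a] (?Bf \<omega>) \<omega>) (2 * length (enlarged_ring ids a [ids ! a]))))
            \<le> (\<Sum>\<omega>\<in>W r. utility a (pref a) (outputs ?n (honest_profile ?A ids \<omega>) (2 * ?n)))"
          proof (rule utility_duplication_le[where r = r])
            show "length [ids ! a] \<le> ?n" using assms(2) by simp
            show "?Bf \<omega> = ?Bf \<omega>'" if "fst \<omega> a = fst \<omega>' a" "snd \<omega> a = snd \<omega>' a" for \<omega> \<omega>'
              using that by (simp add: honest_profile_def)
            show "distinct (enlarged_ring ids a [ids ! a])" unfolding E by (rule assms)
          qed (simp_all add: assms a True W_def)
          then show ?thesis unfolding E eq .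
        next
          case False
          then show ?thesis
            using assms a by (intro sum_mono utility_late_deviation_le) (auto simp: W_def)
        qed
      qed
    }
    {
      fix F S assume F: "F \<noteq> [] \<and> length F \<le> ?n \<and> distinct (enlarged_ring ids a F)"
      show "expected_utility a (pref a) (duplication_outcome ?A ids a F S (posterior ?A ids D a 0 \<omega>\<^sub>0))
        \<le> expected_utility a (pref a) (honest_outcome ?A ids (posterior ?A ids D a 0 \<omega>\<^sub>0))"
        unfolding duplication_outcome_def honest_outcome_def posterior dur
      proof (rule expected_utility_pair_le[OF W])
        fix B
        show "(\<Sum>\<omega>\<in>W 0. utility a (pref a) (outputs ?n (duplication_profile ?A ids a F B \<omega>)
              (2 * length (enlarged_ring ids a F))))
          \<le> (\<Sum>\<omega>\<in>W 0. utility a (pref a) (outputs ?n (honest_profile ?A ids \<omega>) (2 * ?n)))"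
          by (rule utility_duplication_le[where r = 0 and Bf = "\<lambda>_. B"]) 
            (use assms a F in \<open>auto simp: W_def\<close>)
      qed
    }
  qed
qed

end
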